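(* Let $A$ be an abelian group and let $\Gamma=IAut(A)$ be the subgroup of $\mathrm{Aut}(A)$ generated by the inertial automorphisms of $A$. Then: (1) the derived subgroup $\Gamma'$ is contained in $FAut(A)$ and is locally finite; (2) $\Gamma$ is locally central-by-finite, i.e. every finitely generated subgroup of $\Gamma$ has a central subgroup of finite index.
   Context: Abelian groups are written additively. An automorphism $\varphi$ of $A$ is inertial if $(\varphi(X)+X)/X$ is finite for every subgroup $X\le A$. $FAut(A)$ denotes the group of automorphisms of $A$ that act as the identity on some subgroup of finite index in $A$. *)

theory Defs
  imports "HOL-Algebra.Coset" "HOL-Algebra.Generated_Groups"
begin

text \<open>The abelian group A is the whole of a type of class ab_group_add.\<close>

definition subgrp :: "'a::ab_group_add set \<Rightarrow> bool" where
  "subgrp X \<longleftrightarrow> 0 \<in> X \<and> (\<forall>x\<in>X. \<forall>y\<in>X. x + y \<in> X) \<and> (\<forall>x\<in>X. - x \<in> X)"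

definition coset_of :: "'a::ab_group_add set \<Rightarrow> 'a \<Rightarrow> 'a set" where
  "coset_of X y = (\<lambda>x. y + x) ` X"

definition Auts :: "('a::ab_group_add \<Rightarrow> 'a) set" where
  "Auts = {f. bij f \<and> (\<forall>x y. f (x + y) = f x + f y)}"

definition AutG :: "('a::ab_group_add \<Rightarrow> 'a) monoid" where
  "AutG = \<lparr>carrier = Auts, mult = (\<circ>), one = id\<rparr>"

definition inertial :: "('a::ab_group_add \<Rightarrow> 'a) \<Rightarrow> bool" where
  "inertial \<phi> \<longleftrightarrow> \<phi> \<in> Auts \<and>
     (\<forall>X. subgrp X \<longrightarrow> finite (coset_of X ` {\<phi> x + y | x y. x \<in> X \<and> y \<in> X}))"

definition IAut :: "('a::ab_group_add \<Rightarrow> 'a) set" where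
  "IAut = generate AutG {\<phi>. inertial \<phi>}"

definition FAut :: "('a::ab_group_add \<Rightarrow> 'a) set" where
  "FAut = {\<phi> \<in> Auts. \<exists>B. subgrp B \<and> finite (range (coset_of B)) \<and> (\<forall>b\<in>B. \<phi> b = b)}"

definition locally_finite :: "('g, 'b) monoid_scheme \<Rightarrow> 'g set \<Rightarrow> bool" where
  "locally_finite G H \<longleftrightarrow> (\<forall>S. S \<subseteq> H \<and> finite S \<longrightarrow> finite (generate G S))"

definition central_by_finite :: "('g, 'b) monoid_scheme \<Rightarrow> 'g set \<Rightarrow> bool" where
  "central_by_finite G H \<longleftrightarrow> (\<exists>Z. subgroup Z G \<and> Z \<subseteq> H \<and>
      (\<forall>z\<in>Z. \<forall>h\<in>H. z \<otimes>\<^bsub>G\<^esub> h = h \<otimes>\<^bsub>G\<^esub> z) \<and>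
      finite ((\<lambda>h. Z #>\<^bsub>G\<^esub> h) ` H))"

definition locally_central_by_finite :: "('g, 'b) monoid_scheme \<Rightarrow> 'g set \<Rightarrow> bool" where
  "locally_central_by_finite G H \<longleftrightarrow>
     (\<forall>S. S \<subseteq> H \<and> finite S \<longrightarrow> central_by_finite G (generate G S))"

end

theory Submission
  imports Defs "HOL.Modules" "HOL-Computational_Algebra.Primes"
begin

text \<open>Call \<open>M\<close> cochernikov if \<open>A / M\<close> is a Chernikov group. If \<open>A / R\<close> is torsion and \<open>f\<close> is inertial,
  then \<open>f x\<close> is a multiple of \<open>x\<close> modulo \<open>R\<close> for all \<open>x\<close> in some cochernikov \<open>M\<close>; otherwise one
  constructs a subgroup on which \<open>f\<close> is not inertial. Taking for \<open>R\<close> a maximal torsion-free subgroup,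
  the additive commutator \<open>h = f g - g f\<close> of two inertial maps has finite image on such an \<open>M\<close>, so its
  image is a finite group plus a divisible one; \<open>f\<close> and \<open>g\<close> map every element of
  the divisible part to a multiple of itself, so \<open>h\<close> kills that part, which forces it to be trivial.
  Hence inertial maps commute up to endomorphisms with finite image.
  Applying the same fact with \<open>R\<close> torsion-free, respectively \<open>R = e A\<close>, one finds for finitely many
  inertial automorphisms an invariant finite subgroup \<open>W\<close> and an invariant subgroup \<open>K\<close> of finite index
  such that they commute on \<open>K\<close> and modulo \<open>W\<close>. All commutators of the group they generate then
  lie in the finite group of automorphisms that are trivial on \<open>K\<close> and modulo \<open>W\<close>.\<close>

section \<open>Abelian groups as modules over the integers\<close>

text \<open>The inverse of an inertial automorphism need not be inertial: multiplication by a prime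
  \<open>p\<close> on an infinite direct sum of copies of Z[1/p] maps every subgroup into itself,
  but its inverse fails the condition at the direct sum of copies of Z. The finiteness argument is
  therefore run only on finitely many inertial generators, and the invariant subgroups
  \<open>K\<close> and \<open>W\<close> carry the result to words in these and their inverses.
  Inertial endomorphisms are, however, closed under composition and subtraction, and
  \<open>f g - g f\<close> measures how far the group commutator is from the identity; hence the
  additive commutator.

  Finite index would be more convenient than Chernikov quotients, but an \<open>M\<close> chosen
  maximal with a given intersection with \<open>F\<close> only makes \<open>A / M\<close> an
  essential extension of a finite group, which may contain quasicyclic parts. They are why divisible
  subgroups have to be treated.

  The choices of \<open>R\<close> serve opposite ends. If \<open>R\<close> is torsion-free,
  multiples modulo \<open>R\<close> are true multiples on the torsion elements of \<open>M\<close>;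
  and \<open>R = e A\<close> can be placed inside a prescribed subgroup of finite index.\<close>

definition zmul :: "int \<Rightarrow> 'a::ab_group_add \<Rightarrow> 'a" (infixr \<open>\<cdot>\<close> 75) where
  "k \<cdot> x = (\<Sum>i<nat k. x) - (\<Sum>i<nat (- k). x)"

lemma sum_const_add: "(\<Sum>i<m + n. x) = (\<Sum>i<m. x) + (\<Sum>i<n. x::'a::ab_group_add)" for m n :: nat
  by (induction n) (auto simp: algebra_simps)

lemma sum_const_mult: "(\<Sum>i<m * n. x) = (\<Sum>i<m. \<Sum>i<n. x::'a::ab_group_add)" for m n :: nat
  by (induction m) (auto simp: sum_const_add algebra_simps)

text \<open>Any way of writing an integer as a difference of naturals computes the same multiple, so
  the module axioms reduce to identities between constant sums.\<close>

lemma zmul_diff: "(int m - int n) \<cdot> x = (\<Sum>i<m. x) - (\<Sum>i<n. x)"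
proof (cases "n \<le> m")
  case True
  then obtain d where "m = n + d" using le_Suc_ex by blast
  then show ?thesis by (simp add: zmul_def sum_const_add)
next
  case False
  then obtain d where "n = m + d" using le_Suc_ex nat_le_linear by blast
  then show ?thesis by (simp add: zmul_def sum_const_add)
qed

text \<open>Subgroups become submodules and additive maps become module homomorphisms, so spans,
  images and preimages are supplied by module theory.\<close>

interpretation Z: module zmul
proof
  fix k l :: int and x y :: 'a
  obtain a b where k: "k = int a - int b" by (rule int_diff_cases)
  obtain c d where l: "l = int c - int d" by (rule int_diff_cases)
  show "k \<cdot> (x + y) = k \<cdot> x + k \<cdot> y"
    by (simp add: zmul_def sum.distrib)
  have "k + l = int (a + c) - int (b + d)" by (simp add: k l)
  then show "(k + l) \<cdot> x = k \<cdot> x + l \<cdot> x"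
    by (simp only: k l zmul_diff sum_const_add) (simp add: algebra_simps)
  have "k * l = int (a * c + b * d) - int (a * d + b * c)" by (simp add: k l algebra_simps)
  then show "k \<cdot> l \<cdot> x = (k * l) \<cdot> x"
    by (simp only: k l zmul_diff sum_const_add sum_const_mult sum_subtractf) (simp add: algebra_simps)
  show "1 \<cdot> x = x" by (simp add: zmul_def)
qed

lemma subgrp_iff_subspace: "subgrp X \<longleftrightarrow> Z.subspace X"
proof
  assume X: "subgrp X"
  have S: "(\<Sum>i<n. x) \<in> X" if "x \<in> X" for n :: nat and x
    using X that by (induction n) (auto simp: subgrp_def)
  show "Z.subspace X"
    unfolding Z.subspace_def
  proof (intro conjI ballI allI)
    fix c x assume "x \<in> X"
    then show "c \<cdot> x \<in> X" using S X unfolding zmul_def subgrp_def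
      by (metis add.commute uminus_add_conv_diff)
  qed (use X in \<open>auto simp: subgrp_def\<close>)
qed (auto simp: subgrp_def Z.subspace_0 Z.subspace_add Z.subspace_neg)

lemma additive_zmul: "additive f \<Longrightarrow> f (k \<cdot> x) = k \<cdot> f x"
  unfolding zmul_def by (simp add: additive.diff additive.sum)

lemma linear_iff_additive: "module_hom zmul zmul f \<longleftrightarrow> additive f"
  by (auto simp: module_hom_iff additive_def additive_zmul Z.module_axioms)

section \<open>Finiteness modulo a subgroup\<close>

abbreviation lin :: "('a::ab_group_add \<Rightarrow> 'a) \<Rightarrow> bool" where
  "lin f \<equiv> module_hom zmul zmul f"

lemma linI: "(\<And>x y. f (x + y) = f x + f y) \<Longrightarrow> lin f"
  by (simp add: linear_iff_additive additive_def)

lemma lin_id: "lin (\<lambda>x. x)"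
  by (auto intro: linI)

lemma lin_zmul: "lin ((\<cdot>) k)"
  by (auto intro: linI simp: Z.scale_right_distrib)

lemma lin_comp: "lin f \<Longrightarrow> lin g \<Longrightarrow> lin (\<lambda>x. f (g x))"
  by (auto intro: linI simp: module_hom.add)

lemma subspace_vimage_Int:
  assumes "Z.subspace X" "Z.subspace M" "lin f"
  shows "Z.subspace {x \<in> X. f x \<in> M}"
proof -
  have "{x \<in> X. f x \<in> M} = X \<inter> {x. f x \<in> M}" by auto
  then show ?thesis
    using module_hom.subspace_linear_preimage[OF assms(3,2)] assms(1) Z.subspace_inter by metis
qed

definition torsion :: "'a::ab_group_add set" where
  "torsion = {x. \<exists>k>0. k \<cdot> x = 0}"

lemma subspace_torsion: "Z.subspace torsion"
proof (rule Z.subspaceI)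
  show "0 \<in> torsion" by (auto simp: torsion_def intro: exI[of _ 1])
next
  fix x y :: 'a assume "x \<in> torsion" "y \<in> torsion"
  then obtain k l where "k > 0" "l > 0" "k \<cdot> x = 0" "l \<cdot> y = 0" by (auto simp: torsion_def)
  then have "(k * l) \<cdot> x = 0" "(k * l) \<cdot> y = 0"
    by (metis Z.scale_scale Z.scale_zero_right mult.commute)+
  moreover have "k * l > 0" using \<open>k > 0\<close> \<open>l > 0\<close> by simp
  ultimately have "(k * l) \<cdot> (x + y) = 0" "k * l > 0"
    by (simp_all only: Z.scale_right_distrib add_0_left)
  then show "x + y \<in> torsion" by (auto simp: torsion_def)
next
  fix c and x :: 'a assume "x \<in> torsion"
  then obtain k where "k > 0" "k \<cdot> x = 0" by (auto simp: torsion_def)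
  then have "k \<cdot> c \<cdot> x = 0" by (simp only: Z.scale_left_commute[of k c] Z.scale_zero_right)
  then show "c \<cdot> x \<in> torsion" using \<open>k > 0\<close> by (auto simp: torsion_def)
qed

lemma torsionI: "k > 0 \<Longrightarrow> k \<cdot> x \<in> torsion \<Longrightarrow> x \<in> torsion"
  unfolding torsion_def by (auto intro: mult_pos_pos)

lemma torsionI': "k \<noteq> 0 \<Longrightarrow> k \<cdot> x \<in> torsion \<Longrightarrow> x \<in> torsion"
  using torsionI[of k x] torsionI[of "- k" x] Z.subspace_neg[OF subspace_torsion, of "k \<cdot> x"]
  by (cases "k > 0") auto

text \<open>For a subgroup \<open>M\<close> this says that \<open>X\<close> has finite image in
  \<open>A / M\<close>. Representatives replace cosets, and \<open>X\<close> need not contain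
  \<open>M\<close>, so the image of a subgroup under a map can be inserted directly.\<close>

definition fin_mod :: "'a::ab_group_add set \<Rightarrow> 'a set \<Rightarrow> bool" where
  "fin_mod X M \<longleftrightarrow> (\<exists>E. finite E \<and> (\<forall>x\<in>X. \<exists>e\<in>E. x - e \<in> M))"

lemma fin_mod_mono: "fin_mod Y L \<Longrightarrow> X \<subseteq> Y \<Longrightarrow> L \<subseteq> M \<Longrightarrow> fin_mod X M"
  unfolding fin_mod_def by (meson subsetD)

lemma fin_mod_finite: "finite X \<Longrightarrow> Z.subspace M \<Longrightarrow> fin_mod X M"
  unfolding fin_mod_def by (metis Z.subspace_0 diff_self)

lemma fin_mod_subset: "X \<subseteq> M \<Longrightarrow> fin_mod X M"
  unfolding fin_mod_def by (intro exI[of _ "{0}"]) auto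

lemma fin_mod_reps:
  assumes "fin_mod X M" "Z.subspace M"
  obtains E where "finite E" "E \<subseteq> X" "\<And>x. x \<in> X \<Longrightarrow> \<exists>e\<in>E. x - e \<in> M"
proof -
  obtain E0 where E0: "finite E0" "\<And>x. x \<in> X \<Longrightarrow> \<exists>e\<in>E0. x - e \<in> M"
    using assms(1) unfolding fin_mod_def by blast
  define E1 where "E1 = {e\<in>E0. \<exists>x\<in>X. x - e \<in> M}"
  obtain g where g: "\<And>e. e \<in> E1 \<Longrightarrow> g e \<in> X \<and> g e - e \<in> M"
    using bchoice[of E1 "\<lambda>e y. y \<in> X \<and> y - e \<in> M"] by (auto simp: E1_def)
  show thesis
  proof
    show "finite (g ` E1)" using E0 by (simp add: E1_def)
    show "g ` E1 \<subseteq> X" using g by auto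
    fix x assume x: "x \<in> X"
    obtain e where e: "e \<in> E0" "x - e \<in> M" using E0 x by blast
    then have "e \<in> E1" using x by (auto simp: E1_def)
    moreover have "x - g e = (x - e) - (g e - e)" by simp
    ultimately show "\<exists>e\<in>g ` E1. x - e \<in> M"
      using e g Z.subspace_diff[OF assms(2)] by (metis imageI)
  qed
qed

text \<open>Subtracting a preimage of the representative of \<open>f x\<close> moves
  \<open>x\<close> into the part of \<open>X\<close> that \<open>f\<close> sends into
  \<open>M\<close>. With the identity for \<open>f\<close> this gives transitivity and the finite
  index of intersections.\<close>

lemma fin_mod_pullback:
  assumes "Z.subspace X" "lin f" "Z.subspace M"
    and "fin_mod (f ` X) M" "fin_mod {x \<in> X. f x \<in> M} L"
  shows "fin_mod X L"
proof -
  obtain E where E: "finite E" "E \<subseteq> f ` X" "\<And>x. x \<in> f ` X \<Longrightarrow> \<exists>e\<in>E. x - e \<in> M"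
    using fin_mod_reps assms(3,4) by metis
  have "\<forall>e\<in>E. \<exists>y. y \<in> X \<and> f y = e" using E(2) by auto
  then obtain g where g: "\<And>e. e \<in> E \<Longrightarrow> g e \<in> X \<and> f (g e) = e"
    using bchoice[of E "\<lambda>e y. y \<in> X \<and> f y = e"] by blast
  obtain F where F: "finite F" "\<And>x. x \<in> X \<Longrightarrow> f x \<in> M \<Longrightarrow> \<exists>e\<in>F. x - e \<in> L"
    using assms(5) unfolding fin_mod_def by auto
  have "\<exists>e\<in>(\<lambda>(e,y). g e + y) ` (E \<times> F). x - e \<in> L" if x: "x \<in> X" for x
  proof -
    obtain e where e: "e \<in> E" "f x - e \<in> M" using E x by blast
    then have "x - g e \<in> X" "f (x - g e) \<in> M"
      using g x assms(1,2) by (auto simp: Z.subspace_diff module_hom.diff)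
    then obtain y where y: "y \<in> F" "x - g e - y \<in> L" using F by blast
    have "(g e + y) \<in> (\<lambda>(e,y). g e + y) ` (E \<times> F)" using e y by force
    then show ?thesis using y by (metis diff_diff_add)
  qed
  then show ?thesis using E F unfolding fin_mod_def
    by (intro exI[of _ "(\<lambda>(e,y). g e + y) ` (E \<times> F)"]) auto
qed

lemma fin_mod_trans:
  assumes "Z.subspace X" "Z.subspace M" "fin_mod X M" "fin_mod M L"
  shows "fin_mod X L"
  by (rule fin_mod_pullback[OF assms(1) lin_id assms(2)])
     (use assms in \<open>auto elim: fin_mod_mono\<close>)

lemma fin_mod_Int:
  assumes "Z.subspace X" "Z.subspace Y" "fin_mod UNIV X" "fin_mod UNIV Y"
  shows "fin_mod UNIV (X \<inter> Y)"
proof (rule fin_mod_trans)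
  show "fin_mod X (X \<inter> Y)"
    by (rule fin_mod_pullback[OF assms(1) lin_id assms(2)])
       (use assms in \<open>auto intro: fin_mod_mono fin_mod_subset\<close>)
qed (use assms in auto)

text \<open>\<open>T\<close> embeds into \<open>A / M\<close>, so a subset of \<open>T\<close> with
  finite image there is itself finite.\<close>

lemma finite_if_fin_mod:
  assumes "fin_mod X M" "X \<subseteq> T" "Z.subspace T" "Z.subspace M" "T \<inter> M \<subseteq> {0}"
  shows "finite X"
proof -
  obtain E where E: "finite E" "E \<subseteq> X" "\<And>x. x \<in> X \<Longrightarrow> \<exists>e\<in>E. x - e \<in> M"
    using fin_mod_reps assms(1,4) by metis
  have "X \<subseteq> E"
  proof
    fix x assume x: "x \<in> X"
    then obtain e where "e \<in> E" "x - e \<in> M" using E by blast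
    moreover have "x - e \<in> T" using x \<open>e \<in> E\<close> E(2) assms(2,3) Z.subspace_diff by blast
    ultimately show "x \<in> E" using assms(5) by (metis IntI eq_iff_diff_eq_0 singletonD subsetD)
  qed
  then show ?thesis using E finite_subset by blast
qed

lemma fin_mod_pigeonhole:
  assumes "fin_mod Y M" "Z.subspace M" "infinite I" "\<And>i. i \<in> I \<Longrightarrow> y i \<in> Y"
  obtains i j :: nat where "i \<in> I" "j \<in> I" "i < j" "y j - y i \<in> M"
proof -
  obtain E where E: "finite E" "\<And>x. x \<in> Y \<Longrightarrow> \<exists>e\<in>E. x - e \<in> M"
    using assms(1) unfolding fin_mod_def by blast
  have "\<forall>i\<in>I. \<exists>e. e \<in> E \<and> y i - e \<in> M" using E assms(4) by blast
  then obtain e where e: "\<And>i. i \<in> I \<Longrightarrow> e i \<in> E \<and> y i - e i \<in> M"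
    using bchoice[of I "\<lambda>i e. e \<in> E \<and> y i - e \<in> M"] by blast
  have "\<not> inj_on e I"
    using E e assms(3) by (meson finite_imageD finite_subset image_subsetI)
  then obtain i j where ij: "i \<in> I" "j \<in> I" "i \<noteq> j" "e i = e j" by (auto simp: inj_on_def)
  have *: "y k - y l \<in> M" if "k \<in> I" "l \<in> I" "e k = e l" for k l
  proof -
    have "y k - y l = (y k - e k) - (y l - e l)" using that by simp
    then show ?thesis using Z.subspace_diff[OF assms(2)] e that by metis
  qed
  show thesis
    using that[of i j] that[of j i] ij * by (metis linorder_neq_iff)
qed

text \<open>Two of the multiples \<open>i \<cdot> x\<close> agree modulo \<open>M\<close> by the
  pigeonhole principle.\<close>

lemma fin_mod_torsion:
  assumes "fin_mod X M" "Z.subspace X" "Z.subspace M" "x \<in> X"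
  shows "\<exists>k>0. k \<cdot> x \<in> M"
proof -
  have "infinite (UNIV :: nat set)" by simp
  then obtain i j :: nat where "i < j" "int j \<cdot> x - int i \<cdot> x \<in> M"
    by (rule fin_mod_pigeonhole[OF assms(1,3), of UNIV "\<lambda>i. int i \<cdot> x"])
       (use assms Z.subspace_scale in auto)
  then show ?thesis
    by (metis Z.scale_left_diff_distrib diff_gt_0_iff_gt of_nat_less_iff)
qed

lemma common_multiple:
  assumes "finite E" "Z.subspace M" "\<And>e. e \<in> E \<Longrightarrow> \<exists>k>0. k \<cdot> e \<in> M"
  shows "\<exists>K>0. \<forall>e\<in>E. K \<cdot> e \<in> M"
  using assms(1,3)
proof (induction E)
  case empty
  then show ?case by (auto intro: exI[of _ 1])
next
  case (insert x E)
  then obtain k K where "k > 0" "k \<cdot> x \<in> M" "K > 0" "\<And>e. e \<in> E \<Longrightarrow> K \<cdot> e \<in> M" by blast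
  then have "(k * K) \<cdot> e \<in> M" if "e \<in> insert x E" for e
    using that Z.subspace_scale[OF assms(2)] by (metis Z.scale_scale insert_iff mult.commute)
  with \<open>k > 0\<close> \<open>K > 0\<close> show ?case by (intro exI[of _ "k * K"]) simp
qed

lemma fin_mod_exponent:
  assumes "fin_mod X M" "Z.subspace X" "Z.subspace M"
  shows "\<exists>k>0. \<forall>x\<in>X. k \<cdot> x \<in> M"
proof -
  obtain E where E: "finite E" "E \<subseteq> X" "\<And>x. x \<in> X \<Longrightarrow> \<exists>e\<in>E. x - e \<in> M"
    using fin_mod_reps assms by metis
  have "\<exists>k>0. \<forall>e\<in>E. k \<cdot> e \<in> M"
    by (rule common_multiple) (use E assms fin_mod_torsion in blast)+
  then obtain k where k: "k > 0" "\<forall>e\<in>E. k \<cdot> e \<in> M" by blast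
  have "k \<cdot> x \<in> M" if x: "x \<in> X" for x
  proof -
    obtain e where "e \<in> E" "x - e \<in> M" using E x by blast
    then have "k \<cdot> (x - e) + k \<cdot> e \<in> M"
      using k Z.subspace_add[OF assms(3)] Z.subspace_scale[OF assms(3)] by blast
    then show ?thesis by (simp add: Z.scale_right_diff_distrib)
  qed
  then show ?thesis using k by blast
qed

text \<open>By division with remainder, a new generator \<open>a\<close> with
  \<open>k \<cdot> a \<in> R\<close> contributes only the coefficients from \<open>0\<close> to
  \<open>k - 1\<close> modulo \<open>R\<close>.\<close>

lemma fin_mod_span:
  assumes "finite S" "Z.subspace R" "\<And>s. s \<in> S \<Longrightarrow> \<exists>k>0. k \<cdot> s \<in> R"
  shows "fin_mod (Z.span (R \<union> S)) R"
  using assms(1,3)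
proof (induction S)
  case empty
  have "Z.span R = R" using assms(2) by simp
  then show ?case by (simp only: Un_empty_right fin_mod_subset subset_refl)
next
  case (insert a S)
  then obtain k where k: "k > 0" "k \<cdot> a \<in> R" by auto
  from insert obtain E where E: "finite E" "\<And>x. x \<in> Z.span (R \<union> S) \<Longrightarrow> \<exists>e\<in>E. x - e \<in> R"
    unfolding fin_mod_def by auto
  let ?E = "(\<lambda>(i, e). i \<cdot> a + e) ` ({0..<k} \<times> E)"
  have "\<exists>e\<in>?E. x - e \<in> R" if x: "x \<in> Z.span (R \<union> insert a S)" for x
  proof -
    obtain l where l: "x - l \<cdot> a \<in> Z.span (R \<union> S)" using x by (auto simp: Z.span_insert)
    then obtain e where e: "e \<in> E" "x - l \<cdot> a - e \<in> R" using E by blast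
    have "l \<cdot> a = (l div k * k + l mod k) \<cdot> a" by simp
    also have "\<dots> = (l div k) \<cdot> k \<cdot> a + (l mod k) \<cdot> a"
      unfolding Z.scale_left_distrib by simp
    finally have "x - ((l mod k) \<cdot> a + e) = (x - l \<cdot> a - e) + (l div k) \<cdot> k \<cdot> a"
      by (simp add: algebra_simps)
    then have "x - ((l mod k) \<cdot> a + e) \<in> R"
      using e k Z.subspace_add[OF assms(2)] Z.subspace_scale[OF assms(2)] by metis
    moreover have "(l mod k) \<cdot> a + e \<in> ?E"
      using e k by (intro image_eqI[of _ _ "(l mod k, e)"]) auto
    ultimately show ?thesis by blast
  qed
  moreover have "finite ?E" using E by blast
  ultimately show ?case unfolding fin_mod_def by blast
qed

lemma finite_span_torsion:
  assumes "finite S" "S \<subseteq> torsion"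
  shows "finite (Z.span S)"
proof (rule finite_if_fin_mod)
  have "fin_mod (Z.span ({0} \<union> S)) {0}"
    by (rule fin_mod_span) (use assms in \<open>auto simp: torsion_def\<close>)
  then show "fin_mod (Z.span S) {0}"
    by (rule fin_mod_mono) (auto intro: Z.span_mono[THEN subsetD])
  show "Z.span S \<subseteq> Z.span S" ..
qed auto

text \<open>Zorn's lemma gives \<open>M\<close> maximal with \<open>M \<inter> F = R\<close>. Adding
  an \<open>x\<close> outside \<open>M\<close> must enlarge the intersection, so every nontrivial
  cyclic subgroup of \<open>A / M\<close> meets the image of \<open>F\<close> nontrivially:
  \<open>A / M\<close> is an essential extension of \<open>F / R\<close>.\<close>

lemma maximal_avoiding:
  assumes "Z.subspace R" "Z.subspace F" "R \<subseteq> F"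
  obtains M where "Z.subspace M" "R \<subseteq> M" "M \<inter> F = R"
    "\<And>x. x \<notin> M \<Longrightarrow> \<exists>k. \<exists>m\<in>M. k \<cdot> x + m \<in> F - R"
proof -
  define \<A> where "\<A> = {M. Z.subspace M \<and> R \<subseteq> M \<and> M \<inter> F = R}"
  have "\<exists>M\<in>\<A>. \<forall>X\<in>\<A>. M \<subseteq> X \<longrightarrow> X = M"
  proof (rule subset_Zorn_nonempty)
    show "\<A> \<noteq> {}" using assms by (auto simp: \<A>_def)
    fix C assume C: "C \<noteq> {}" "subset.chain \<A> C"
    have "Z.subspace (\<Union>C)"
    proof (rule Z.subspaceI)
      obtain X where "X \<in> C" "Z.subspace X" using C by (auto simp: subset_chain_def \<A>_def)
      then show "0 \<in> \<Union>C" using Z.subspace_0 by blast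
      fix x y assume "x \<in> \<Union>C" "y \<in> \<Union>C"
      then obtain X Y where XY: "X \<in> C" "Y \<in> C" "x \<in> X" "y \<in> Y" by blast
      then consider "X \<subseteq> Y" | "Y \<subseteq> X" using C by (auto simp: subset_chain_def)
      moreover have "Z.subspace X" "Z.subspace Y" using C XY by (auto simp: subset_chain_def \<A>_def)
      ultimately show "x + y \<in> \<Union>C"
        using XY by (meson UnionI Z.subspace_add subsetD)
    next
      fix c x assume "x \<in> \<Union>C"
      then show "c \<cdot> x \<in> \<Union>C" using C Z.subspace_scale
        by (fastforce simp: subset_chain_def \<A>_def)
    qed
    then show "\<Union>C \<in> \<A>" using C by (auto simp: subset_chain_def \<A>_def)
  qed
  then obtain M where M: "M \<in> \<A>" "\<And>X. X \<in> \<A> \<Longrightarrow> M \<subseteq> X \<Longrightarrow> X = M" by blast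
  then have sM: "Z.subspace M" "R \<subseteq> M" "M \<inter> F = R" by (auto simp: \<A>_def)
  have "\<exists>k. \<exists>m\<in>M. k \<cdot> x + m \<in> F - R" if x: "x \<notin> M" for x
  proof (rule ccontr)
    assume neg: "\<not> ?thesis"
    have "Z.span M = M" using sM(1) by simp
    then have sp: "Z.span (insert x M) = {y. \<exists>k. y - k \<cdot> x \<in> M}"
      unfolding Z.span_insert by (rule ssubst) (rule refl)
    have "M \<subseteq> Z.span (insert x M)" using Z.span_superset by blast
    moreover have "Z.span (insert x M) \<inter> F \<subseteq> R"
    proof
      fix y assume y: "y \<in> Z.span (insert x M) \<inter> F"
      then obtain k where "y - k \<cdot> x \<in> M" using sp by auto
      with neg y show "y \<in> R"
        by (metis DiffI IntD2 add.commute diff_add_cancel)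
    qed
    ultimately have "Z.span (insert x M) \<in> \<A>" using sM assms unfolding \<A>_def by blast
    then have "Z.span (insert x M) = M" using M \<open>M \<subseteq> Z.span (insert x M)\<close> by blast
    then show False using x Z.span_base by blast
  qed
  then show thesis using that sM by blast
qed

section \<open>Chernikov quotients\<close>

text \<open>The quotient by \<open>M\<close> is a Chernikov group, i.e. a direct sum of finitely many
  cyclic and quasicyclic \<open>p\<close>-groups.\<close>

definition cochernikov :: "'a::ab_group_add set \<Rightarrow> bool" where
  "cochernikov M \<longleftrightarrow> Z.subspace M \<and> (\<exists>N>0. \<forall>x. \<exists>k::nat. N ^ k \<cdot> x \<in> M) \<and>
     (\<forall>q>0. fin_mod {x. q \<cdot> x \<in> M} M)"

lemma power_zmul_mono:
  assumes "Z.subspace M" "N ^ k \<cdot> x \<in> M" "k \<le> l"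
  shows "(N::int) ^ l \<cdot> x \<in> M"
proof -
  have "N ^ l = N ^ (l - k) * N ^ k" using assms(3) by (simp flip: power_add)
  then show ?thesis using assms by (metis Z.scale_scale Z.subspace_scale)
qed

lemma power_zmul_dvd:
  assumes "Z.subspace M" "N ^ k \<cdot> x \<in> M" "N dvd N'"
  shows "(N'::int) ^ k \<cdot> x \<in> M"
proof -
  obtain c where "N' = N * c" using assms(3) by blast
  then have "N' ^ k = c ^ k * N ^ k" by (simp add: power_mult_distrib)
  then show ?thesis using assms by (metis Z.scale_scale Z.subspace_scale)
qed

lemma subspace_zmul_in:
  assumes "Z.subspace M" shows "Z.subspace {x. q \<cdot> x \<in> M}"
  using module_hom.subspace_linear_preimage[OF lin_zmul assms] .

text \<open>Multiplication by a prime factor \<open>r\<close> maps the elements killed by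
  \<open>r * q\<close> modulo \<open>M\<close> to elements killed by \<open>q\<close>, and what it
  sends into \<open>M\<close> is killed by \<open>r\<close>.\<close>

lemma fin_mod_multiples:
  assumes M: "Z.subspace M" and p: "\<And>p::int. prime p \<Longrightarrow> fin_mod {x. p \<cdot> x \<in> M} M"
  shows "q > 0 \<Longrightarrow> fin_mod {x. q \<cdot> x \<in> M} M"
proof (induction q rule: prime_divisors_induct)
  case (unit q)
  then have "q = 1" by (simp add: zdvd1_eq)
  then show ?case by (auto intro: fin_mod_subset)
next
  case (factor r q)
  then have "q > 0" using prime_gt_0_int zero_less_mult_pos by blast
  with factor have q: "fin_mod {x. q \<cdot> x \<in> M} M" by blast
  show ?case
  proof (rule fin_mod_pullback[OF subspace_zmul_in[OF M] lin_zmul M])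
    show "fin_mod ((\<cdot>) r ` {x. (r * q) \<cdot> x \<in> M}) M"
      by (rule fin_mod_mono[OF q]) (auto simp: mult.commute)
    show "fin_mod {x \<in> {x. (r * q) \<cdot> x \<in> M}. r \<cdot> x \<in> M} M"
      by (rule fin_mod_mono[OF p[OF factor(1)]]) auto
  qed
qed simp

lemma bezout_member:
  assumes "Z.subspace M" "coprime a b" "a \<cdot> x \<in> M" "b \<cdot> x \<in> M"
  shows "x \<in> M"
proof -
  obtain u v where "u * a + v * b = 1" using assms(2) bezout_int[of a b] by auto
  then have "x = u \<cdot> a \<cdot> x + v \<cdot> b \<cdot> x"
    by (metis Z.scale_left_distrib Z.scale_one Z.scale_scale)
  then show ?thesis using assms by (metis Z.subspace_add Z.subspace_scale)
qed

text \<open>An essential extension of a finite group is Chernikov: it has no torsion at primes not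
  dividing the exponent \<open>N\<close> of \<open>F / R\<close>, and its elements of prime order
  come from \<open>F\<close>.\<close>

lemma cochernikov_avoiding:
  assumes R: "Z.subspace R" and F: "Z.subspace F" and RF: "R \<subseteq> F" and fin: "fin_mod F R"
  obtains M where "cochernikov M" "R \<subseteq> M" "M \<inter> F = R"
proof -
  obtain M where M: "Z.subspace M" "R \<subseteq> M" "M \<inter> F = R"
    and max: "\<And>x. x \<notin> M \<Longrightarrow> \<exists>k. \<exists>m\<in>M. k \<cdot> x + m \<in> F - R"
    using maximal_avoiding[OF R F RF] by metis
  obtain N where N: "N > 0" "\<And>x. x \<in> F \<Longrightarrow> N \<cdot> x \<in> R" using fin_mod_exponent[OF fin F R] by blast
  have coprime: "x \<in> M" if h: "coprime h N" "h \<cdot> x \<in> M" for h x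
  proof (rule ccontr)
    assume "x \<notin> M"
    then obtain k m where f: "m \<in> M" "k \<cdot> x + m \<in> F" "k \<cdot> x + m \<notin> R" using max by blast
    have "h \<cdot> (k \<cdot> x + m) = k \<cdot> h \<cdot> x + h \<cdot> m"
      by (simp add: Z.scale_right_distrib mult.commute)
    then have "h \<cdot> (k \<cdot> x + m) \<in> M" using h f M by (metis Z.subspace_add Z.subspace_scale)
    then have "h \<cdot> (k \<cdot> x + m) \<in> R" using Z.subspace_scale[OF F f(2)] M by blast
    then show False using bezout_member[OF R h(1)] N f by blast
  qed
  have torsion: "\<exists>h>0. h \<cdot> x \<in> M" for x
  proof (cases "x \<in> M")
    case False
    then obtain k m where f: "m \<in> M" "k \<cdot> x + m \<in> F" "k \<cdot> x + m \<notin> R" using max by blast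
    have "k \<noteq> 0" using f M by auto
    have "N \<cdot> (k \<cdot> x + m) - N \<cdot> m \<in> M"
      using N f M Z.subspace_diff[OF M(1)] Z.subspace_scale[OF M(1)] by blast
    then have "(N * k) \<cdot> x \<in> M" by (simp add: Z.scale_right_distrib)
    then have "\<bar>N * k\<bar> \<cdot> x \<in> M"
      using Z.subspace_neg[OF M(1)] by (cases "N * k \<ge> 0") auto
    then show ?thesis using \<open>k \<noteq> 0\<close> N by (intro exI[of _ "\<bar>N * k\<bar>"]) auto
  qed (auto intro: exI[of _ 1])
  have primary: "\<exists>k. N ^ k \<cdot> x \<in> M" if "int h \<cdot> x \<in> M" "h > 0" for h x
    using that
  proof (induction h arbitrary: x rule: less_induct)
    case (less h)
    show ?case
    proof (cases "coprime (int h) N")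
      case True
      then have "x \<in> M" using coprime less.prems by blast
      then show ?thesis by (intro exI[of _ 0]) simp
    next
      case False
      \<comment> \<open>The annihilator \<open>h\<close> is reduced by its common factor with
        \<open>N\<close>. Since \<open>g\<close> divides \<open>N\<close>, one more power of
        \<open>N\<close> makes up for it.\<close>
      define g where "g = nat (gcd (int h) N)"
      have g: "int g = gcd (int h) N" by (simp add: g_def)
      have "int g \<noteq> 1" "int g > 0"
        unfolding g using False less.prems by (auto simp: coprime_iff_gcd_eq_1)
      then have "g \<noteq> 1" "g > 0" by auto
      moreover obtain d where d: "h = d * g"
        using g by (metis dvd_def gcd_dvd1 int_dvd_int_iff mult.commute)
      ultimately have "d < h" "d > 0" "int d \<cdot> int g \<cdot> x \<in> M"
        using less.prems by auto
      then obtain k where k: "N ^ k \<cdot> int g \<cdot> x \<in> M" using less.IH by blast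
      obtain c where c: "N = c * int g" using g by (metis dvd_def gcd_dvd2 mult.commute)
      have "N ^ Suc k \<cdot> x = c \<cdot> N ^ k \<cdot> int g \<cdot> x" by (simp add: c algebra_simps)
      then show ?thesis using k M(1) Z.subspace_scale by metis
    qed
  qed
  have "fin_mod {x. p \<cdot> x \<in> M} M" if p: "prime p" for p
  proof -
    obtain E where E: "finite E" "\<And>x. x \<in> F \<Longrightarrow> \<exists>e\<in>E. x - e \<in> R"
      using fin unfolding fin_mod_def by blast
    have "\<exists>e\<in>insert 0 E. x - e \<in> M" if x: "p \<cdot> x \<in> M" for x
    proof (cases "x \<in> M")
      case False
      then obtain k m where f: "m \<in> M" "k \<cdot> x + m \<in> F" "k \<cdot> x + m \<notin> R" using max by blast
      \<comment> \<open>As \<open>p \<cdot> x \<in> M\<close> but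
        \<open>k \<cdot> x \<notin> M\<close>, the coefficient \<open>k\<close> is prime to
        \<open>p\<close>. Bezout then shows that \<open>x\<close> agrees modulo \<open>M\<close>
        with \<open>v\<close> times the element \<open>k \<cdot> x + m\<close> of
        \<open>F\<close>.\<close>
      have "k \<cdot> x \<notin> M" using f M Z.subspace_add by blast
      then have "\<not> p dvd k" using x M(1) by (metis Z.scale_scale Z.subspace_scale dvd_def mult.commute)
      then have "coprime p k" using p prime_imp_coprime by blast
      then obtain u v where uv: "u * p + v * k = 1" using bezout_int[of p k] by auto
      have "v \<cdot> (k \<cdot> x + m) \<in> F" using f F Z.subspace_scale by blast
      then obtain e where e: "e \<in> E" "v \<cdot> (k \<cdot> x + m) - e \<in> R" using E by blast
      have "x = u \<cdot> p \<cdot> x + v \<cdot> k \<cdot> x"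
        using uv by (metis Z.scale_left_distrib Z.scale_one Z.scale_scale)
      then have "x - e = u \<cdot> p \<cdot> x + (v \<cdot> (k \<cdot> x + m) - e) - v \<cdot> m"
        by (simp add: Z.scale_right_distrib algebra_simps)
      moreover have "\<dots> \<in> M"
        by (rule Z.subspace_diff[OF M(1) Z.subspace_add[OF M(1) Z.subspace_scale[OF M(1) x]
                subsetD[OF M(2) e(2)]] Z.subspace_scale[OF M(1) f(1)]])
      ultimately have "x - e \<in> M" by (simp only:)
      then show ?thesis using e(1) by blast
    qed auto
    then show ?thesis using E(1) unfolding fin_mod_def by (intro exI[of _ "insert 0 E"]) auto
  qed
  then have "cochernikov M"
    unfolding cochernikov_def using M(1) N(1) fin_mod_multiples[OF M(1)] torsion primary
    by (metis zero_less_imp_eq_int of_nat_0_less_iff)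
  then show thesis using that M by blast
qed

lemma cochernikov_UNIV: "cochernikov UNIV"
  unfolding cochernikov_def by (auto intro: fin_mod_subset exI[of _ 1])

text \<open>By \<open>x \<mapsto> (x, f x)\<close> the quotient embeds into the sum of
  \<open>A / M\<close> and \<open>A / L\<close>; the two nested pullbacks treat the two coordinates
  in turn.\<close>

lemma cochernikov_Collect:
  assumes M: "cochernikov M" and L: "cochernikov L" and f: "lin f"
  shows "cochernikov {x \<in> M. f x \<in> L}" (is "cochernikov ?P")
proof -
  have sM: "Z.subspace M" and sL: "Z.subspace L" using M L by (auto simp: cochernikov_def)
  have sP: "Z.subspace ?P" using subspace_vimage_Int sM sL f by blast
  obtain N N' where N: "N > 0" "\<And>x. \<exists>k::nat. N ^ k \<cdot> x \<in> M" "N' > 0" "\<And>x. \<exists>k::nat. N' ^ k \<cdot> x \<in> L"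
    using M L unfolding cochernikov_def by metis
  have "\<exists>k. (N * N') ^ k \<cdot> x \<in> ?P" for x
  proof -
    obtain k l where kl: "N ^ k \<cdot> x \<in> M" "N' ^ l \<cdot> f x \<in> L" using N by meson
    have "(N * N') ^ (k + l) \<cdot> x \<in> M" "(N * N') ^ (k + l) \<cdot> f x \<in> L"
      using power_zmul_mono[OF sM power_zmul_dvd[OF sM kl(1), of "N * N'"], of "k + l"]
        power_zmul_mono[OF sL power_zmul_dvd[OF sL kl(2), of "N * N'"], of "k + l"] by auto
    then show ?thesis by (auto simp: module_hom.scale[OF f])
  qed
  moreover have "fin_mod {x. q \<cdot> x \<in> ?P} ?P" if q: "q > 0" for q
  proof (rule fin_mod_pullback[OF subspace_zmul_in[OF sP] f sL])
    show "fin_mod (f ` {x. q \<cdot> x \<in> ?P}) L"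
    proof (rule fin_mod_mono)
      show "fin_mod {x. q \<cdot> x \<in> L} L" using L q by (auto simp: cochernikov_def)
    qed (auto simp: module_hom.scale[OF f])
    show "fin_mod {x \<in> {x. q \<cdot> x \<in> ?P}. f x \<in> L} ?P"
    proof (rule fin_mod_pullback[OF subspace_vimage_Int[OF subspace_zmul_in[OF sP] sL f] lin_id sM])
      have "fin_mod {x. q \<cdot> x \<in> M} M" using M q by (auto simp: cochernikov_def)
      then show "fin_mod ((\<lambda>x. x) ` {x \<in> {x. q \<cdot> x \<in> ?P}. f x \<in> L}) M"
        by (rule fin_mod_mono) auto
    qed (auto intro: fin_mod_subset)
  qed
  ultimately show ?thesis
    unfolding cochernikov_def using sP N by (intro conjI exI[of _ "N * N'"]) auto
qed

text \<open>\<open>A / L\<close> has the finite subgroup \<open>M / L\<close> with Chernikov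
  quotient \<open>A / M\<close>. The factor \<open>e\<close>, which kills \<open>M / L\<close>,
  accounts for the finite part.\<close>

lemma cochernikov_finite_index:
  assumes M: "cochernikov M" and L: "Z.subspace L" "L \<subseteq> M" "fin_mod M L"
  shows "cochernikov L"
proof -
  have sM: "Z.subspace M" using M by (simp add: cochernikov_def)
  obtain N where N: "N > 0" "\<And>x. \<exists>k::nat. N ^ k \<cdot> x \<in> M"
    using M unfolding cochernikov_def by metis
  obtain e where e: "e > 0" "\<And>x. x \<in> M \<Longrightarrow> e \<cdot> x \<in> L" using fin_mod_exponent[OF L(3) sM L(1)] by blast
  have "\<exists>k. (N * e) ^ k \<cdot> x \<in> L" for x
  proof -
    obtain k where "N ^ k \<cdot> x \<in> M" using N by blast
    then have "(N * e) ^ k \<cdot> x \<in> M" by (rule power_zmul_dvd[OF sM]) simp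
    then have "N \<cdot> e \<cdot> (N * e) ^ k \<cdot> x \<in> L" using e L Z.subspace_scale by blast
    then show ?thesis by (intro exI[of _ "Suc k"]) (simp add: mult.assoc)
  qed
  moreover have "fin_mod {x. q \<cdot> x \<in> L} L" if "q > 0" for q
  proof (rule fin_mod_trans[OF subspace_zmul_in[OF L(1)] sM _ L(3)])
    show "fin_mod {x. q \<cdot> x \<in> L} M"
      by (rule fin_mod_mono[of "{x. q \<cdot> x \<in> M}" M]) (use M L that in \<open>auto simp: cochernikov_def\<close>)
  qed
  ultimately show ?thesis
    unfolding cochernikov_def using L N e by (intro conjI exI[of _ "N * e"]) auto
qed

section \<open>Inertial endomorphisms modulo a cotorsion subgroup\<close>

text \<open>Invertibility is dropped, so that composites and differences, in particular additive
  commutators, are again of this kind. Finiteness of the image of \<open>f X\<close> in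
  \<open>A / X\<close> is finiteness of \<open>(f X + X) / X\<close>.\<close>

definition inert :: "('a::ab_group_add \<Rightarrow> 'a) \<Rightarrow> bool" where
  "inert f \<longleftrightarrow> lin f \<and> (\<forall>X. Z.subspace X \<longrightarrow> fin_mod (f ` X) X)"

lemma inert_lin: "inert f \<Longrightarrow> lin f"
  by (simp add: inert_def)

lemma inert_fin_mod: "inert f \<Longrightarrow> Z.subspace X \<Longrightarrow> fin_mod (f ` X) X"
  by (simp add: inert_def)

lemma subspace_chain_Union:
  assumes "\<And>n::nat. Z.subspace (S n)" "\<And>m n. m \<le> n \<Longrightarrow> S m \<subseteq> S n"
  shows "Z.subspace (\<Union>n. S n)"
proof (rule Z.subspaceI)
  fix x y assume "x \<in> (\<Union>n. S n)" "y \<in> (\<Union>n. S n)"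
  then obtain m n where "x \<in> S m" "y \<in> S n" by blast
  then have "x \<in> S (max m n)" "y \<in> S (max m n)" using assms(2) max.cobounded1 max.cobounded2 by blast+
  then show "x + y \<in> (\<Union>n. S n)" using assms(1) Z.subspace_add by blast
next
  show "0 \<in> (\<Union>n. S n)" using Z.subspace_0[OF assms(1)] by blast
next
  fix c x assume "x \<in> (\<Union>n. S n)"
  then obtain n where "x \<in> S n" by blast
  then show "c \<cdot> x \<in> (\<Union>n. S n)" using Z.subspace_scale[OF assms(1)] by blast
qed

lemma span_chain_Union:
  assumes "\<And>m n::nat. m \<le> n \<Longrightarrow> S m \<subseteq> S n" "x \<in> Z.span (\<Union>n. S n)"
  shows "\<exists>n. x \<in> Z.span (S n)"
proof -
  have "Z.span (\<Union>n. S n) \<subseteq> (\<Union>n. Z.span (S n))"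
  proof (rule Z.span_minimal)
    show "\<Union> (range S) \<subseteq> (\<Union>n. Z.span (S n))" using Z.span_superset by blast
    show "Z.subspace (\<Union>n. Z.span (S n))"
      by (rule subspace_chain_Union) (auto simp: assms(1) Z.span_mono)
  qed
  then show ?thesis using assms(2) by blast
qed

text \<open>If no such \<open>M\<close> exists, one can choose \<open>x\<^sub>0, x\<^sub>1, \<dots>\<close> such that the pairs \<open>x\<^sub>i, f x\<^sub>i\<close> are
  independent modulo \<open>R\<close> and \<open>f x\<^sub>i\<close> is not a multiple of \<open>x\<^sub>i\<close> modulo \<open>R\<close>; then \<open>f\<close> is not
  inertial on the subgroup generated by \<open>R\<close> and the \<open>x\<^sub>i\<close>.\<close>

lemma inert_almost_multiple:
  assumes f: "inert f" and R: "Z.subspace R" and tq: "\<And>x. \<exists>k>0. k \<cdot> x \<in> R"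
  shows "\<exists>M. cochernikov M \<and> (\<forall>x\<in>M. \<exists>k. f x - k \<cdot> x \<in> R) \<and> {x \<in> R. f x \<in> R} \<subseteq> M"
proof (rule ccontr)
  assume neg: "\<not> ?thesis"
  have "\<exists>x M. Z.subspace M \<and> M \<inter> Z.span (R \<union> S) = R \<and> x \<in> M \<and> f x \<in> M \<and> (\<forall>k. f x - k \<cdot> x \<notin> R)"
    if S: "finite S" for S
  proof -
    obtain M where M: "cochernikov M" "R \<subseteq> M" "M \<inter> Z.span (R \<union> S) = R"
    proof (rule cochernikov_avoiding[OF R])
      show "fin_mod (Z.span (R \<union> S)) R" by (rule fin_mod_span[OF S R tq])
      show "R \<subseteq> Z.span (R \<union> S)" using Z.span_superset by blast
    qed auto
    have "cochernikov {x \<in> M. f x \<in> M}" by (rule cochernikov_Collect[OF M(1,1) inert_lin[OF f]])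
    then have "\<not> (\<forall>x\<in>{x \<in> M. f x \<in> M}. \<exists>k. f x - k \<cdot> x \<in> R)" using neg M(2) by blast
    then show ?thesis using M by (auto simp: cochernikov_def)
  qed
  then obtain p L where p: "\<And>S. finite S \<Longrightarrow> Z.subspace (L S) \<and> L S \<inter> Z.span (R \<union> S) = R
      \<and> p S \<in> L S \<and> f (p S) \<in> L S \<and> (\<forall>k. f (p S) - k \<cdot> p S \<notin> R)"
    by metis
  \<comment> \<open>\<open>s n\<close> collects the first \<open>n\<close> pairs. The next pair is
    taken in a subgroup \<open>L (s n)\<close> that meets the span of \<open>R\<close> and the
    earlier pairs only in \<open>R\<close>.\<close>
  define s where "s = rec_nat {} (\<lambda>_ S. S \<union> {p S, f (p S)})"
  have s_Suc: "s (Suc n) = s n \<union> {p (s n), f (p (s n))}" and s_0: "s 0 = {}" for n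
    by (auto simp: s_def)
  have fin: "finite (s n)" for n by (induction n) (auto simp: s_0 s_Suc)
  have mono: "s m \<subseteq> s n" if "m \<le> n" for m n
    by (rule lift_Suc_mono_le[OF _ that]) (auto simp: s_Suc)
  define x where "x n = p (s n)" for n
  define F where "F n = Z.span (R \<union> s n)" for n
  have xM: "Z.subspace (L (s n))" "L (s n) \<inter> F n = R" "x n \<in> L (s n)" "f (x n) \<in> L (s n)"
    "f (x n) - k \<cdot> x n \<notin> R" for n k
    using p[OF fin, of n] by (auto simp: x_def F_def)
  have F_mono: "F m \<subseteq> F n" if "m \<le> n" for m n
    unfolding F_def using mono[OF that] by (intro Z.span_mono) auto
  have sF: "Z.subspace (F n)" for n by (simp add: F_def)
  have xF: "x m \<in> F n" "f (x m) \<in> F n" if "m < n" for m n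
    using F_mono[of "Suc m" n] that
    by (auto simp: F_def s_Suc x_def intro!: Z.span_base elim!: subsetD)
  define X where "X n = Z.span (R \<union> x ` {..<n})" for n
  have X_mono: "X m \<subseteq> X n" if "m \<le> n" for m n
    unfolding X_def using that by (intro Z.span_mono) auto
  have RF: "R \<subseteq> F n" for n unfolding F_def using Z.span_superset by blast
  have XF: "X n \<subseteq> F n" for n
    unfolding X_def by (rule Z.span_minimal) (use RF xF sF in auto)
  have X_Suc: "\<exists>k. y - k \<cdot> x n \<in> X n" if "y \<in> X (Suc n)" for y n
    using that by (simp add: X_def lessThan_Suc Z.span_insert)
  have RX: "R \<subseteq> X n" for n unfolding X_def using Z.span_superset by blast
  have sX: "Z.subspace (X n)" for n by (simp add: X_def)
  \<comment> \<open>Independence modulo \<open>R\<close>: if \<open>y\<close> lies in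
    \<open>F m\<close>, then the contribution of a generator \<open>x n\<close> with
    \<open>n \<ge> m\<close> lies in both \<open>F n\<close> and \<open>L (s n)\<close>, hence in
    \<open>R\<close>, and can be absorbed.\<close>
  have desc: "y \<in> X m" if "y \<in> X n" "y \<in> F m" for y m n
    using that
  proof (induction n)
    case (Suc n)
    show ?case
    proof (cases "Suc n \<le> m")
      case True
      then show ?thesis using Suc X_mono by blast
    next
      case False
      obtain k where k: "y - k \<cdot> x n \<in> X n" using X_Suc Suc by blast
      have "y \<in> F n" using F_mono[of m n] False Suc by auto
      then have "y - (y - k \<cdot> x n) \<in> F n" using k XF sF Z.subspace_diff by blast
      then have "k \<cdot> x n \<in> F n" by simp
      then have "k \<cdot> x n \<in> X n" using xM(1,2,3)[of n] Z.subspace_scale RX by blast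
      then have "(y - k \<cdot> x n) + k \<cdot> x n \<in> X n" using k sX Z.subspace_add by blast
      then show ?thesis using Suc by simp
    qed
  next
    case 0
    then show ?case using X_mono by blast
  qed
  define Y where "Y = Z.span (\<Union>n. R \<union> x ` {..<n})"
  have YX: "\<exists>n. y \<in> X n" if "y \<in> Y" for y
    unfolding X_def by (rule span_chain_Union[OF _ that[unfolded Y_def]]) auto
  have xY: "x n \<in> Y" for n unfolding Y_def by (rule Z.span_base) auto
  have "fin_mod (f ` Y) Y" using inert_fin_mod[OF f] by (simp add: Y_def)
  then obtain i j :: nat where ij: "i < j" "f (x j) - f (x i) \<in> Y"
  proof (rule fin_mod_pigeonhole)
    show "Z.subspace Y" "infinite (UNIV :: nat set)" by (auto simp: Y_def)
    show "f (x i) \<in> f ` Y" for i using xY by blast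
  qed
  \<comment> \<open>The difference lies in \<open>Y\<close> and in \<open>F (Suc j)\<close>, so by
    \<open>desc\<close> it involves only \<open>x 0, ..., x j\<close>. After isolating
    \<open>x j\<close>, the element \<open>f (x j) - k \<cdot> x j\<close> falls into
    \<open>F j\<close> and into \<open>L (s j)\<close>, hence into \<open>R\<close>, against the
    choice of \<open>x j\<close>.\<close>
  have "f (x j) - f (x i) \<in> F (Suc j)" using ij xF sF Z.subspace_diff by (metis less_Suc_eq)
  then have "f (x j) - f (x i) \<in> X (Suc j)" using YX ij desc by blast
  then obtain k where k: "f (x j) - f (x i) - k \<cdot> x j \<in> X j" using X_Suc by blast
  have "f (x i) + (f (x j) - f (x i) - k \<cdot> x j) \<in> F j"
    using k XF xF ij sF Z.subspace_add by blast
  then have "f (x j) - k \<cdot> x j \<in> F j" by (simp add: algebra_simps)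
  moreover have "f (x j) - k \<cdot> x j \<in> L (s j)"
    using xM Z.subspace_diff Z.subspace_scale by metis
  ultimately show False using xM by blast
qed

text \<open>The last clause matters when all of \<open>\<Phi>\<close> maps \<open>R\<close> into
  itself: it then yields \<open>R \<subseteq> M\<close>.\<close>

lemma inert_almost_multiple_finite:
  assumes "finite \<Phi>" "\<And>f. f \<in> \<Phi> \<Longrightarrow> inert f" and R: "Z.subspace R" and tq: "\<And>x. \<exists>k>0. k \<cdot> x \<in> R"
  shows "\<exists>M. cochernikov M \<and> (\<forall>f\<in>\<Phi>. \<forall>x\<in>M. \<exists>k. f x - k \<cdot> x \<in> R) \<and> {x \<in> R. \<forall>f\<in>\<Phi>. f x \<in> R} \<subseteq> M"
  using assms(1,2)
proof (induction \<Phi>)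
  case empty
  then show ?case using cochernikov_UNIV by auto
next
  case (insert f \<Phi>)
  then obtain M where M: "cochernikov M" "\<forall>f\<in>\<Phi>. \<forall>x\<in>M. \<exists>k. f x - k \<cdot> x \<in> R"
    "{x \<in> R. \<forall>f\<in>\<Phi>. f x \<in> R} \<subseteq> M" by auto
  obtain L where L: "cochernikov L" "\<forall>x\<in>L. \<exists>k. f x - k \<cdot> x \<in> R" "{x \<in> R. f x \<in> R} \<subseteq> L"
    using inert_almost_multiple[OF _ R tq] insert.prems by blast
  have "cochernikov {x \<in> M. x \<in> L}" by (rule cochernikov_Collect[OF M(1) L(1) lin_id])
  then show ?case using M L by (intro exI[of _ "{x \<in> M. x \<in> L}"]) auto
qed

section \<open>Inertial endomorphisms modulo torsion\<close>

text \<open>\<open>R\<close> is maximal with trivial torsion. For \<open>x\<close> outside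
  \<open>R\<close> some \<open>k \<cdot> x + m\<close> is a nonzero torsion element, and a positive
  multiple killing it leaves a multiple of \<open>x\<close> with nonzero coefficient in
  \<open>R\<close>.\<close>

lemma torsion_free_cotorsion:
  obtains R :: "'a::ab_group_add set"
  where "Z.subspace R" "R \<inter> torsion = {0}" "\<And>x. \<exists>k>0. k \<cdot> x \<in> R"
proof -
  obtain R :: "'a set" where R: "Z.subspace R" "{0} \<subseteq> R" "R \<inter> torsion = {0}"
    and max: "\<And>x. x \<notin> R \<Longrightarrow> \<exists>k. \<exists>m\<in>R. k \<cdot> x + m \<in> torsion - {0}"
    by (rule maximal_avoiding[OF Z.subspace_single_0 subspace_torsion])
       (auto simp: Z.subspace_0 subspace_torsion)
  have "\<exists>k>0. k \<cdot> x \<in> R" for x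
  proof (cases "x \<in> R")
    case False
    then obtain k m where m: "m \<in> R" "k \<cdot> x + m \<in> torsion" "k \<cdot> x + m \<noteq> 0" using max by blast
    then obtain l where l: "l > 0" "l \<cdot> (k \<cdot> x + m) = 0" by (auto simp: torsion_def)
    have "k \<noteq> 0"
    proof
      assume "k = 0"
      then have "m \<in> R \<inter> torsion" "m \<noteq> 0" using m by simp_all
      then show False using R(3) by blast
    qed
    have "l \<cdot> (k \<cdot> x + m) - l \<cdot> m \<in> R"
      using l m Z.subspace_diff[OF R(1)] Z.subspace_scale[OF R(1)] Z.subspace_0[OF R(1)] by metis
    then have "(l * k) \<cdot> x \<in> R" by (simp add: Z.scale_right_distrib)
    then have "\<bar>l * k\<bar> \<cdot> x \<in> R"
      using Z.subspace_neg[OF R(1)] by (cases "l * k \<ge> 0") auto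
    then show ?thesis using \<open>k \<noteq> 0\<close> l by (intro exI[of _ "\<bar>l * k\<bar>"]) auto
  qed (auto intro: exI[of _ 1])
  then show thesis using that R by blast
qed

lemma lin_torsion: "lin f \<Longrightarrow> x \<in> torsion \<Longrightarrow> f x \<in> torsion"
  unfolding torsion_def by (auto simp flip: module_hom.scale simp: module_hom.zero)

lemma inert_eigenvector:
  assumes "inert f" shows "\<exists>n>0. \<exists>m. n \<cdot> f x = m \<cdot> x"
proof -
  have "\<exists>k>0. k \<cdot> f x \<in> Z.span {x}"
  proof (rule fin_mod_torsion)
    show "fin_mod (f ` Z.span {x}) (Z.span {x})" by (rule inert_fin_mod[OF assms]) simp
    show "Z.subspace (f ` Z.span {x})"
      by (rule module_hom.subspace_image[OF inert_lin[OF assms]]) simp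
  qed (auto intro: Z.span_base)
  then show ?thesis by (auto simp: Z.span_singleton)
qed

text \<open>Modulo torsion the map is multiplication by the rational number \<open>m / n\<close>. As
  for linear maps with every vector an eigenvector, the value is fixed at one \<open>a\<close> of
  infinite order; for \<open>y\<close> independent of \<open>a\<close> the values at
  \<open>a\<close>, \<open>y\<close> and \<open>a + y\<close> are compared.\<close>

lemma inert_rational:
  assumes f: "inert f"
  shows "\<exists>n>0. \<exists>m. \<forall>x. n \<cdot> f x - m \<cdot> x \<in> torsion"
proof (cases "torsion = (UNIV :: 'a set)")
  case True
  then show ?thesis by (auto intro: exI[of _ 1])
next
  case False
  then obtain a :: 'a where a: "a \<notin> torsion" by blast
  obtain n m where nm: "n > 0" "n \<cdot> f a = m \<cdot> a" using inert_eigenvector[OF f] by blast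
  have "n \<cdot> f y - m \<cdot> y \<in> torsion" for y
  proof (cases "\<exists>i j. j \<noteq> 0 \<and> i \<cdot> a = j \<cdot> y")
    case True
    then obtain i j where ij: "j \<noteq> 0" "i \<cdot> a = j \<cdot> y" by blast
    have "j \<cdot> (n \<cdot> f y - m \<cdot> y) = n \<cdot> f (j \<cdot> y) - m \<cdot> j \<cdot> y"
      by (simp add: Z.scale_right_diff_distrib module_hom.scale[OF inert_lin[OF f]] mult.commute)
    also have "\<dots> = i \<cdot> (n \<cdot> f a - m \<cdot> a)"
      by (simp add: Z.scale_right_diff_distrib module_hom.scale[OF inert_lin[OF f]] mult.commute
          flip: ij(2))
    finally have "j \<cdot> (n \<cdot> f y - m \<cdot> y) = 0" using nm by simp
    then show ?thesis using torsionI'[OF ij(1)] Z.subspace_0[OF subspace_torsion] by metis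
  next
    case False
    then have indep: "i = 0 \<and> j = 0" if "i \<cdot> a = j \<cdot> y" for i j
      using that torsionI'[of i a] a Z.subspace_0[OF subspace_torsion] by (metis Z.scale_zero_left)
    obtain n' m' where nm': "n' > 0" "n' \<cdot> f y = m' \<cdot> y" using inert_eigenvector[OF f] by blast
    obtain k l where kl: "k > 0" "k \<cdot> f (a + y) = l \<cdot> (a + y)" using inert_eigenvector[OF f] by blast
    have "(n * n') \<cdot> k \<cdot> f (a + y) = (n' * k) \<cdot> n \<cdot> f a + (n * k) \<cdot> n' \<cdot> f y"
      by (simp add: module_hom.add[OF inert_lin[OF f]] Z.scale_right_distrib ac_simps)
    then have "(n * n' * l) \<cdot> a + (n * n' * l) \<cdot> y = (n' * k * m) \<cdot> a + (n * k * m') \<cdot> y"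
      unfolding nm nm' kl by (simp add: Z.scale_right_distrib)
    then have "(n * n' * l - n' * k * m) \<cdot> a = (n * k * m' - n * n' * l) \<cdot> y"
      by (simp add: Z.scale_left_diff_distrib algebra_simps)
    then have "n * n' * l - n' * k * m = 0" "n * k * m' - n * n' * l = 0" using indep by blast+
    then have "n' * k * m = n * k * m'" by linarith
    then have "k * (n' * m) = k * (n * m')" by (simp only: ac_simps)
    then have e: "n' * m = n * m'" using kl by simp
    have "n' \<cdot> (n \<cdot> f y - m \<cdot> y) = n \<cdot> n' \<cdot> f y - (n' * m) \<cdot> y"
      by (simp add: Z.scale_right_diff_distrib mult.commute)
    also have "\<dots> = 0" unfolding nm' e by simp
    finally show ?thesis using torsionI[OF nm'(1)] Z.subspace_0[OF subspace_torsion] by metis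
  qed
  then show ?thesis using nm by blast
qed

text \<open>Modulo torsion both products act as the same rational number
  \<open>m m' / (n n')\<close>.\<close>

lemma inert_commutator_torsion:
  assumes f: "inert f" and g: "inert g"
  shows "f (g x) - g (f x) \<in> torsion"
proof -
  obtain n m where n: "n > 0" "\<And>x. n \<cdot> f x - m \<cdot> x \<in> torsion" using inert_rational[OF f] by blast
  obtain n' m' where n': "n' > 0" "\<And>x. n' \<cdot> g x - m' \<cdot> x \<in> torsion" using inert_rational[OF g] by blast
  note T = Z.subspace_add[OF subspace_torsion] Z.subspace_diff[OF subspace_torsion]
    Z.subspace_scale[OF subspace_torsion]
  have "n \<cdot> f (n' \<cdot> g x - m' \<cdot> x) + m' \<cdot> (n \<cdot> f x - m \<cdot> x) \<in> torsion"
    by (rule T(1)[OF T(3)[OF lin_torsion[OF inert_lin[OF f] n'(2)]] T(3)[OF n(2)]])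
  then have 1: "(n * n') \<cdot> f (g x) - (m * m') \<cdot> x \<in> torsion"
    by (simp add: module_hom.diff[OF inert_lin[OF f]] module_hom.scale[OF inert_lin[OF f]]
        Z.scale_right_diff_distrib mult.commute)
  have "n' \<cdot> g (n \<cdot> f x - m \<cdot> x) + m \<cdot> (n' \<cdot> g x - m' \<cdot> x) \<in> torsion"
    by (rule T(1)[OF T(3)[OF lin_torsion[OF inert_lin[OF g] n(2)]] T(3)[OF n'(2)]])
  then have 2: "(n * n') \<cdot> g (f x) - (m * m') \<cdot> x \<in> torsion"
    by (simp add: module_hom.diff[OF inert_lin[OF g]] module_hom.scale[OF inert_lin[OF g]]
        Z.scale_right_diff_distrib mult.commute)
  have "(n * n') \<cdot> (f (g x) - g (f x)) \<in> torsion"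
    using T(2)[OF 1 2] by (simp add: Z.scale_right_diff_distrib)
  then show ?thesis using torsionI[of "n * n'"] n n' by simp
qed

section \<open>Divisible subgroups\<close>

lemma inert_comp:
  assumes f: "inert f" and g: "inert g"
  shows "inert (\<lambda>x. f (g x))"
  unfolding inert_def
proof (intro conjI allI impI)
  show "lin (\<lambda>x. f (g x))" using lin_comp inert_lin assms by blast
  fix X :: "'a set" assume X: "Z.subspace X"
  obtain E where E: "finite E" "\<And>x. x \<in> X \<Longrightarrow> \<exists>e\<in>E. f x - e \<in> X"
    using inert_fin_mod[OF f X] unfolding fin_mod_def by auto
  obtain F where F: "finite F" "\<And>x. x \<in> X \<Longrightarrow> \<exists>e\<in>F. g x - e \<in> X"
    using inert_fin_mod[OF g X] unfolding fin_mod_def by auto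
  have "\<exists>e\<in>(\<lambda>(a, b). a + f b) ` (E \<times> F). f (g x) - e \<in> X" if x: "x \<in> X" for x
  proof -
    obtain b where b: "b \<in> F" "g x - b \<in> X" using F x by blast
    then obtain a where a: "a \<in> E" "f (g x - b) - a \<in> X" using E by blast
    then have "f (g x) - (a + f b) \<in> X"
      by (simp add: module_hom.diff[OF inert_lin[OF f]] algebra_simps)
    then show ?thesis using a(1) b(1) by force
  qed
  then show "fin_mod ((\<lambda>x. f (g x)) ` X) X"
    unfolding fin_mod_def using E F by (intro exI[of _ "(\<lambda>(a, b). a + f b) ` (E \<times> F)"]) auto
qed

lemma inert_diff:
  assumes f: "inert f" and g: "inert g"
  shows "inert (\<lambda>x. f x - g x)"
  unfolding inert_def
proof (intro conjI allI impI)
  show "lin (\<lambda>x. f x - g x)"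
    by (rule linI) (simp add: module_hom.add[OF inert_lin[OF f]] module_hom.add[OF inert_lin[OF g]])
  fix X :: "'a set" assume X: "Z.subspace X"
  obtain E where E: "finite E" "\<And>x. x \<in> X \<Longrightarrow> \<exists>e\<in>E. f x - e \<in> X"
    using inert_fin_mod[OF f X] unfolding fin_mod_def by auto
  obtain F where F: "finite F" "\<And>x. x \<in> X \<Longrightarrow> \<exists>e\<in>F. g x - e \<in> X"
    using inert_fin_mod[OF g X] unfolding fin_mod_def by auto
  have "\<exists>e\<in>(\<lambda>(a, b). a - b) ` (E \<times> F). f x - g x - e \<in> X" if x: "x \<in> X" for x
  proof -
    obtain a b where ab: "a \<in> E" "f x - a \<in> X" "b \<in> F" "g x - b \<in> X" using E F x by meson
    then have "(f x - a) - (g x - b) \<in> X" using X Z.subspace_diff by blast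
    then have "f x - g x - (a - b) \<in> X" by (simp add: algebra_simps)
    then show ?thesis using ab by force
  qed
  then show "fin_mod ((\<lambda>x. f x - g x) ` X) X"
    unfolding fin_mod_def using E F by (intro exI[of _ "(\<lambda>(a, b). a - b) ` (E \<times> F)"]) auto
qed

lemma order_mod:
  assumes M: "Z.subspace M" and "\<exists>k>0. k \<cdot> x \<in> M"
  shows "\<exists>h>0. \<forall>m. m \<cdot> x \<in> M \<longleftrightarrow> h dvd m"
proof -
  let ?P = "\<lambda>n::nat. n > 0 \<and> int n \<cdot> x \<in> M"
  obtain k where "k > 0" "k \<cdot> x \<in> M" using assms(2) by blast
  then have "?P (nat k)" by simp
  then obtain h where h: "?P h" and least: "\<And>n. n < h \<Longrightarrow> \<not> ?P n"
    using exists_least_iff[of ?P] by blast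
  have "m \<cdot> x \<in> M \<longleftrightarrow> int h dvd m" for m
  proof
    assume m: "m \<cdot> x \<in> M"
    have "m mod int h = m - (m div int h) * int h" by (simp add: minus_div_mult_eq_mod)
    then have "(m mod int h) \<cdot> x = m \<cdot> x - (m div int h) \<cdot> int h \<cdot> x"
      by (simp only: Z.scale_left_diff_distrib Z.scale_scale)
    then have "(m mod int h) \<cdot> x \<in> M"
      using m h Z.subspace_diff[OF M] Z.subspace_scale[OF M] by metis
    moreover have "m mod int h < int h" "m mod int h \<ge> 0" using h by simp_all
    ultimately have "\<not> m mod int h > 0" using least[of "nat (m mod int h)"] by auto
    then show "int h dvd m" using \<open>m mod int h \<ge> 0\<close> by (simp add: dvd_eq_mod_eq_0)
  next
    assume "int h dvd m"
    then obtain c where "m = c * int h" by (metis dvd_def mult.commute)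
    then show "m \<cdot> x \<in> M" using h Z.subspace_scale[OF M] by (metis Z.scale_scale)
  qed
  then show ?thesis using h by (intro exI[of _ "int h"]) simp
qed

text \<open>In a finite cyclic group an element belongs to a subgroup as soon as its order divides
  that of the subgroup. With \<open>h\<close> the order of \<open>g\<close>, the hypothesis amounts
  to \<open>gcd s h dvd t\<close>.\<close>

lemma multiple_in_cyclic:
  assumes g: "g \<in> torsion" and ann: "\<And>m. m \<cdot> s \<cdot> g = 0 \<Longrightarrow> m \<cdot> t \<cdot> g = 0"
  shows "\<exists>c. t \<cdot> g = c \<cdot> s \<cdot> g"
proof -
  obtain h where h: "h > 0" "\<And>m. m \<cdot> g = 0 \<longleftrightarrow> h dvd m"
    using order_mod[OF Z.subspace_single_0, of g] g by (auto simp: torsion_def)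
  obtain u v where uv: "u * s + v * h = gcd s h" using bezout_int by blast
  obtain s' where s': "s = gcd s h * s'" by (meson dvd_def gcd_dvd1)
  obtain h' where h': "h = gcd s h * h'" by (meson dvd_def gcd_dvd2)
  have "h' \<noteq> 0" using h h' by auto
  have "h' * s = s' * h" by (subst s', subst h') simp
  then have "(h' * s) \<cdot> g = 0" using h by simp
  then have "h dvd h' * t" using ann[of h'] h by simp
  then have "gcd s h dvd t" using h' \<open>h' \<noteq> 0\<close> by (metis dvd_mult_cancel_left mult.commute)
  then obtain c where c: "t = gcd s h * c" by (meson dvd_def)
  have "t = c * u * s + c * v * h" unfolding c uv[symmetric] by (simp add: algebra_simps)
  then have "t \<cdot> g = (c * u * s) \<cdot> g + (c * v * h) \<cdot> g" by (simp only: Z.scale_left_distrib)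
  moreover have "(c * v * h) \<cdot> g = 0" using h by simp
  ultimately show ?thesis by (intro exI[of _ "c * u"]) simp
qed

lemma common_power:
  assumes "finite E" "Z.subspace M" "\<And>e. e \<in> E \<Longrightarrow> \<exists>k::nat. (N::int) ^ k \<cdot> e \<in> M"
  shows "\<exists>K. \<forall>e\<in>E. N ^ K \<cdot> e \<in> M"
  using assms(1,3)
proof (induction E)
  case (insert x E)
  then obtain k K where "N ^ k \<cdot> x \<in> M" "\<And>e. e \<in> E \<Longrightarrow> N ^ K \<cdot> e \<in> M" by blast
  then have "N ^ max k K \<cdot> e \<in> M" if "e \<in> insert x E" for e
    using that power_zmul_mono[OF assms(2)] by (metis insert_iff max.cobounded1 max.cobounded2)
  then show ?case by blast
qed auto

lemma divisible_power:
  assumes "\<And>d. d \<in> D \<Longrightarrow> \<exists>d'\<in>D. d = (N::int) \<cdot> d'" "d \<in> D"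
  shows "\<exists>d'\<in>D. d = N ^ k \<cdot> d'"
proof (induction k)
  case 0
  then show ?case using assms(2) by auto
next
  case (Suc k)
  then obtain a b where "a \<in> D" "d = N ^ k \<cdot> a" "b \<in> D" "a = N \<cdot> b" using assms(1) by metis
  then show ?case by (intro bexI[of _ b]) (simp_all add: mult.commute)
qed

text \<open>Integers prime to \<open>N\<close> act invertibly on an \<open>N\<close>-primary group.
  Otherwise the common factor \<open>g\<close> of \<open>k\<close> and \<open>N\<close> is split off
  by writing \<open>d = N \<cdot> d1\<close>, which leaves the smaller \<open>k'\<close>.\<close>

lemma divisible_primary_divisible:
  assumes D: "Z.subspace D" and N: "N > 0"
    and div: "\<And>d. d \<in> D \<Longrightarrow> \<exists>d'\<in>D. d = N \<cdot> d'"
    and prim: "\<And>d. d \<in> D \<Longrightarrow> \<exists>k::nat. N ^ k \<cdot> d = 0"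
  shows "0 < k \<Longrightarrow> d \<in> D \<Longrightarrow> \<exists>d'\<in>D. d = int k \<cdot> d'"
proof (induction k arbitrary: d rule: less_induct)
  case (less k)
  show ?case
  proof (cases "coprime (int k) N")
    case True
    obtain j where j: "N ^ j \<cdot> d = 0" using prim less.prems by blast
    have "coprime (int k) (N ^ j)" using True by simp
    then obtain u v where "u * int k + v * N ^ j = 1" using bezout_int[of "int k" "N ^ j"] by auto
    then have "d = u \<cdot> int k \<cdot> d + v \<cdot> N ^ j \<cdot> d"
      by (metis Z.scale_left_distrib Z.scale_one Z.scale_scale)
    then have "d = int k \<cdot> u \<cdot> d" using j by (simp add: mult.commute)
    then show ?thesis using Z.subspace_scale[OF D less.prems(2)] by blast
  next
    case False
    define g where "g = nat (gcd (int k) N)"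
    have g: "int g = gcd (int k) N" by (simp add: g_def)
    have "int g \<noteq> 1" "int g > 0"
      unfolding g using False less.prems by (auto simp: coprime_iff_gcd_eq_1)
    then have "g \<noteq> 1" "g > 0" by auto
    moreover obtain k' where k': "k = k' * g"
      using g by (metis dvd_def gcd_dvd1 int_dvd_int_iff mult.commute)
    ultimately have "k' < k" "0 < k'" using less.prems by auto
    obtain c where c: "N = int g * c" using g by (metis dvd_def gcd_dvd2)
    obtain d1 where d1: "d1 \<in> D" "d = N \<cdot> d1" using div less.prems by blast
    obtain d2 where "d2 \<in> D" "c \<cdot> d1 = int k' \<cdot> d2"
      using less.IH[OF \<open>k' < k\<close> \<open>0 < k'\<close> Z.subspace_scale[OF D d1(1)]] by blast
    moreover have "d = int g \<cdot> c \<cdot> d1" by (simp add: d1 c)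
    ultimately show ?thesis by (intro bexI[of _ d2]) (simp_all add: k' mult.commute)
  qed
qed

text \<open>\<open>d\<close> lies in a locally cyclic \<open>N\<close>-divisible subgroup \<open>P\<close> of \<open>D\<close>; as \<open>(f P + P)/P\<close> is finite and divisible,
  \<open>f\<close> maps \<open>P\<close> into itself.\<close>

lemma inert_multiple_on_divisible:
  assumes f: "inert f" and D: "Z.subspace D"
    and div: "\<And>d. d \<in> D \<Longrightarrow> \<exists>d'\<in>D. d = (N::int) \<cdot> d'"
    and prim: "\<And>d. d \<in> D \<Longrightarrow> \<exists>k::nat. N ^ k \<cdot> d = 0" and N: "N > 0"
    and d: "d \<in> D"
  shows "\<exists>c. f d = c \<cdot> d"
proof -
  have "\<exists>s. \<forall>n. (s n \<in> D \<and> (n = 0 \<longrightarrow> s n = d)) \<and> s n = N \<cdot> s (Suc n)"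
    by (rule dependent_nat_choice) (use d div in auto)
  then obtain s where s: "\<And>n. s n \<in> D" "s 0 = d" "\<And>n. s n = N \<cdot> s (Suc n)" by blast
  define P where "P = (\<Union>n. Z.span {s n})"
  have mono: "Z.span {s m} \<subseteq> Z.span {s n}" if "m \<le> n" for m n
  proof (rule lift_Suc_mono_le[OF _ that])
    fix n
    show "Z.span {s n} \<subseteq> Z.span {s (Suc n)}"
    proof (rule Z.span_minimal)
      have "N \<cdot> s (Suc n) \<in> Z.span {s (Suc n)}" by (intro Z.span_scale Z.span_base) simp
      then show "{s n} \<subseteq> Z.span {s (Suc n)}" by (simp flip: s(3))
    qed simp
  qed
  have sP: "Z.subspace P" unfolding P_def by (rule subspace_chain_Union) (auto simp: mono)
  have PD: "P \<subseteq> D"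
    unfolding P_def by (intro UN_least Z.span_minimal D) (simp add: s(1))
  have divP: "\<exists>y\<in>P. x = N \<cdot> y" if xP: "x \<in> P" for x
  proof -
    obtain n k where x: "x = k \<cdot> s n" using xP by (auto simp: P_def Z.span_singleton)
    have "x = N \<cdot> k \<cdot> s (Suc n)" by (subst x, subst s(3)) (simp add: mult.commute)
    moreover have "k \<cdot> s (Suc n) \<in> P" by (auto simp: P_def Z.span_singleton)
    ultimately show ?thesis by blast
  qed
  obtain E where E: "finite E" "E \<subseteq> f ` P" "\<And>x. x \<in> f ` P \<Longrightarrow> \<exists>e\<in>E. x - e \<in> P"
    using fin_mod_reps[OF inert_fin_mod[OF f sP] sP] by metis
  have "\<exists>K. \<forall>e\<in>E. N ^ K \<cdot> e \<in> {0}"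
  proof (rule common_power[OF E(1)])
    fix e assume "e \<in> E"
    then obtain y where y: "y \<in> P" "e = f y" using E by blast
    then obtain k where "N ^ k \<cdot> y = 0" using prim PD by blast
    then have "N ^ k \<cdot> e = 0"
      using y by (simp add: module_hom.zero[OF inert_lin[OF f]] flip: module_hom.scale[OF inert_lin[OF f]])
    then show "\<exists>k. N ^ k \<cdot> e \<in> {0}" by blast
  qed simp
  then obtain K where K: "\<And>e. e \<in> E \<Longrightarrow> N ^ K \<cdot> e = 0" by auto
  have fP: "f x \<in> P" if xP: "x \<in> P" for x
  proof -
    obtain y where y: "y \<in> P" "x = N ^ K \<cdot> y" using divisible_power[OF divP xP] by blast
    obtain e where e: "e \<in> E" "f y - e \<in> P" using E y by blast
    have "f x = N ^ K \<cdot> (f y - e)"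
      using K[OF e(1)] y by (simp add: Z.scale_right_diff_distrib module_hom.scale[OF inert_lin[OF f]])
    then show ?thesis using e Z.subspace_scale[OF sP] by metis
  qed
  have "d \<in> P" unfolding P_def using s(2) Z.span_base by blast
  then obtain n where "f d \<in> Z.span {s n}" using fP by (auto simp: P_def)
  moreover have "d \<in> Z.span {s n}" using mono[of 0 n] s(2) Z.span_base by blast
  ultimately obtain i j where ij: "d = i \<cdot> s n" "f d = j \<cdot> s n" by (auto simp: Z.span_singleton)
  \<comment> \<open>Both \<open>d\<close> and \<open>f d\<close> lie in the finite cyclic group
    generated by \<open>s n\<close>, and every integer killing \<open>d\<close> also kills
    \<open>f d\<close>.\<close>
  have "\<exists>c. j \<cdot> s n = c \<cdot> i \<cdot> s n"
  proof (rule multiple_in_cyclic)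
    obtain k where "N ^ k \<cdot> s n = 0" using prim[OF s(1)] by blast
    then show "s n \<in> torsion" using N by (auto simp: torsion_def intro!: exI[of _ "N ^ k"])
    fix m assume "m \<cdot> i \<cdot> s n = 0"
    then have "f (m \<cdot> d) = 0" using ij module_hom.zero[OF inert_lin[OF f]] by simp
    then show "m \<cdot> j \<cdot> s n = 0" using ij module_hom.scale[OF inert_lin[OF f]] by metis
  qed
  then show ?thesis using ij by metis
qed

lemma subspace_sums:
  assumes "Z.subspace C" "Z.subspace D"
  shows "Z.subspace {c + d |c d. c \<in> C \<and> d \<in> D}"
proof -
  have "Z.span C = C" "Z.span D = D" using assms by auto
  then have "{c + d |c d. c \<in> C \<and> d \<in> D} = Z.span (C \<union> D)" by (simp only: Z.span_Un)
  then show ?thesis by simp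
qed

text \<open>The classical splitting of divisible subgroups: \<open>C\<close> is maximal with trivial
  intersection with \<open>D\<close>, and an \<open>a\<close> outside \<open>C + D\<close> could be
  changed by an element of \<open>D\<close> so that adding it to \<open>C\<close> keeps the
  intersection trivial.\<close>

lemma divisible_complement:
  assumes D: "Z.subspace D" and div: "\<And>k d. k > 0 \<Longrightarrow> d \<in> D \<Longrightarrow> \<exists>d'\<in>D. d = k \<cdot> d'"
  obtains C where "Z.subspace C" "C \<inter> D = {0}" "\<And>a. \<exists>d\<in>D. a - d \<in> C"
proof -
  obtain C where C: "Z.subspace C" "C \<inter> D = {0}"
    and max: "\<And>x. x \<notin> C \<Longrightarrow> \<exists>k. \<exists>m\<in>C. k \<cdot> x + m \<in> D - {0}"
    by (rule maximal_avoiding[OF Z.subspace_single_0 D]) (auto simp: Z.subspace_0 D)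
  have "\<exists>d\<in>D. a - d \<in> C" for a
  proof (rule ccontr)
    assume neg: "\<not> ?thesis"
    define S where "S = {c + d |c d. c \<in> C \<and> d \<in> D}"
    have sS: "Z.subspace S" unfolding S_def by (rule subspace_sums[OF C(1) D])
    have "a \<notin> C" using neg Z.subspace_0[OF D] by force
    then obtain k m where m: "m \<in> C" "k \<cdot> a + m \<in> D" "k \<cdot> a + m \<noteq> 0" using max by blast
    have "k \<noteq> 0"
    proof
      assume "k = 0"
      then have "m \<in> C \<inter> D" "m \<noteq> 0" using m by simp_all
      then show False using C(2) by blast
    qed
    have "k \<cdot> a = - m + (k \<cdot> a + m)" by simp
    then have kS: "k \<cdot> a \<in> S" unfolding S_def using m Z.subspace_neg[OF C(1)] by blast
    then have "\<bar>k\<bar> \<cdot> a \<in> S" using Z.subspace_neg[OF sS] by (cases "k \<ge> 0") auto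
    then have "\<exists>k>0. k \<cdot> a \<in> S" using \<open>k \<noteq> 0\<close> by (intro exI[of _ "\<bar>k\<bar>"]) simp
    then obtain h where h: "h > 0" "\<And>m. m \<cdot> a \<in> S \<longleftrightarrow> h dvd m" using order_mod[OF sS] by blast
    \<comment> \<open>\<open>h\<close> is the order of \<open>a\<close> modulo \<open>C + D\<close>.
      Divisibility removes the \<open>D\<close>-component of \<open>h \<cdot> a\<close>, so
      \<open>h \<cdot> (a - d') = c\<close>, and every multiple of \<open>a - d'\<close> in
      \<open>C + D\<close> already lies in \<open>C\<close>.\<close>
    then have "h \<cdot> a \<in> S" by simp
    then obtain c d where cd: "c \<in> C" "d \<in> D" "h \<cdot> a = c + d" by (auto simp: S_def)
    obtain d' where d': "d' \<in> D" "d = h \<cdot> d'" using div[OF h(1) cd(2)] by blast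
    have "a - d' \<notin> C" using neg d' by blast
    then obtain j n where n: "n \<in> C" "j \<cdot> (a - d') + n \<in> D" "j \<cdot> (a - d') + n \<noteq> 0" using max by blast
    have "j \<cdot> a = - n + ((j \<cdot> (a - d') + n) + j \<cdot> d')" by (simp add: Z.scale_right_diff_distrib)
    moreover have "- n \<in> C" "(j \<cdot> (a - d') + n) + j \<cdot> d' \<in> D"
      using n d' Z.subspace_neg[OF C(1)] Z.subspace_add[OF D] Z.subspace_scale[OF D] by blast+
    ultimately have "j \<cdot> a \<in> S" unfolding S_def by blast
    then obtain i where i: "j = i * h" using h by (metis dvd_def mult.commute)
    have "j \<cdot> (a - d') = i \<cdot> c"
      unfolding i Z.scale_scale[symmetric] Z.scale_right_diff_distrib cd d' Z.scale_right_distrib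
      by simp
    then have "j \<cdot> (a - d') + n \<in> C" using n cd Z.subspace_add[OF C(1)] Z.subspace_scale[OF C(1)] by metis
    then show False using n C(2) by blast
  qed
  then show thesis using that C by blast
qed

section \<open>Commutators of inertial endomorphisms\<close>

lemma decreasing_finite_sets_stabilise:
  assumes "finite E" "\<And>m n::nat. m \<le> n \<Longrightarrow> S n \<subseteq> S m"
  shows "\<exists>n. \<forall>j\<ge>n. E \<inter> S j = E \<inter> S n"
proof -
  obtain n where n: "\<And>m. card (E \<inter> S n) \<le> card (E \<inter> S m)"
    using ex_has_least_nat[of "\<lambda>_. True" _ "\<lambda>n. card (E \<inter> S n)"] by blast
  have "E \<inter> S j = E \<inter> S n" if "j \<ge> n" for j
    using assms n[of j] assms(2)[OF that] by (intro card_seteq) auto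
  then show ?thesis by blast
qed

text \<open>For \<open>Q = A / M\<close> the claim is that \<open>N ^ n Q\<close> is
  \<open>N\<close>-divisible and that \<open>Q\<close> is the sum of \<open>N ^ n Q\<close> and the
  elements killed by \<open>N ^ n\<close>. The elements of \<open>N ^ j Q\<close> killed by
  \<open>N\<close> form a decreasing chain in a finite group; \<open>n\<close> is where it becomes
  constant.\<close>

lemma cochernikov_powers_stabilise:
  assumes M: "Z.subspace M" and N: "fin_mod {x. N \<cdot> x \<in> M} M"
    and prim: "\<And>x. \<exists>k::nat. N ^ k \<cdot> x \<in> M"
  shows "\<exists>n. (\<forall>x. \<exists>y. N ^ n \<cdot> x - N ^ Suc n \<cdot> y \<in> M) \<and> (\<forall>x. \<exists>y. N ^ n \<cdot> (x - N ^ n \<cdot> y) \<in> M)"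
proof -
  define S where "S n = {x. N \<cdot> x \<in> M \<and> (\<exists>y. x - N ^ n \<cdot> y \<in> M)}" for n
  obtain E where E: "finite E" "E \<subseteq> {x. N \<cdot> x \<in> M}" "\<And>x. x \<in> {x. N \<cdot> x \<in> M} \<Longrightarrow> \<exists>e\<in>E. x - e \<in> M"
    using fin_mod_reps[OF N M] by metis
  have "\<exists>n. \<forall>j\<ge>n. E \<inter> S j = E \<inter> S n"
  proof (rule decreasing_finite_sets_stabilise[OF E(1)])
    fix m n :: nat assume "m \<le> n"
    then have "N ^ n = N ^ m * N ^ (n - m)" by (simp flip: power_add)
    then have "N ^ n \<cdot> y = N ^ m \<cdot> N ^ (n - m) \<cdot> y" for y :: 'a by (simp only: Z.scale_scale)
    then have "x - N ^ n \<cdot> y \<in> M \<Longrightarrow> \<exists>y. x - N ^ m \<cdot> y \<in> M" for x y :: 'a by metis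
    then show "S n \<subseteq> S m" unfolding S_def by blast
  qed
  then obtain n where n: "\<And>j. j \<ge> n \<Longrightarrow> E \<inter> S j = E \<inter> S n" by blast
  have S: "x \<in> S j" if x: "x \<in> S n" and "j \<ge> n" for x j
  proof -
    obtain e where e: "e \<in> E" "x - e \<in> M" using E x by (auto simp: S_def)
    obtain y where "x - N ^ n \<cdot> y \<in> M" using x by (auto simp: S_def)
    then have "(x - N ^ n \<cdot> y) - (x - e) \<in> M" using e Z.subspace_diff[OF M] by blast
    then have "e \<in> S n" using e E(2) by (auto simp: S_def)
    then have "e \<in> S j" using n[OF \<open>j \<ge> n\<close>] e by blast
    then obtain z where "e - N ^ j \<cdot> z \<in> M" by (auto simp: S_def)
    then have "(x - e) + (e - N ^ j \<cdot> z) \<in> M" using e Z.subspace_add[OF M] by blast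
    then show ?thesis using x by (auto simp: S_def)
  qed
  have "\<exists>y. N ^ n \<cdot> x - N ^ Suc n \<cdot> y \<in> M" if "N ^ k \<cdot> N ^ n \<cdot> x \<in> M" for k x
    using that
  proof (induction k arbitrary: x)
    case 0
    then show ?case by (intro exI[of _ 0]) simp
  next
    case (Suc k)
    define z where "z = N ^ k \<cdot> N ^ n \<cdot> x"
    have "z = N ^ n \<cdot> N ^ k \<cdot> x" by (simp add: z_def mult.commute)
    then have "\<exists>y. z - N ^ n \<cdot> y \<in> M" using Z.subspace_0[OF M] by (metis diff_self)
    moreover have "N \<cdot> z \<in> M" using Suc.prems by (simp add: z_def mult.assoc)
    ultimately have "z \<in> S n" by (simp add: S_def)
    \<comment> \<open>With this exponent \<open>z\<close> agrees modulo \<open>M\<close> with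
      \<open>N ^ k \<cdot> N ^ n \<cdot> N \<cdot> w\<close>, so the induction hypothesis for
      \<open>k\<close> applies to \<open>x - N \<cdot> w\<close>.\<close>
    then have "z \<in> S (n + k + 1)" by (rule S) simp
    then obtain w where w: "z - N ^ (n + k + 1) \<cdot> w \<in> M" by (auto simp: S_def)
    have "z - N ^ (n + k + 1) \<cdot> w = N ^ k \<cdot> N ^ n \<cdot> (x - N \<cdot> w)"
      by (simp add: z_def Z.scale_right_diff_distrib power_add mult.commute mult.left_commute)
    then obtain y where y: "N ^ n \<cdot> (x - N \<cdot> w) - N ^ Suc n \<cdot> y \<in> M" using Suc.IH w by metis
    have "N ^ n \<cdot> (x - N \<cdot> w) - N ^ Suc n \<cdot> y = N ^ n \<cdot> x - N ^ Suc n \<cdot> (w + y)"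
      by (simp add: Z.scale_right_diff_distrib Z.scale_right_distrib mult.commute)
    then show ?case using y by metis
  qed
  then have step: "\<exists>y. N ^ n \<cdot> x - N ^ Suc n \<cdot> y \<in> M" for x using prim by blast
  have iter: "\<exists>y. N ^ n \<cdot> x - N ^ (n + j) \<cdot> y \<in> M" for x j
  proof (induction j)
    case 0
    then show ?case using Z.subspace_0[OF M] by (intro exI[of _ x]) simp
  next
    case (Suc j)
    then obtain y z where y: "N ^ n \<cdot> x - N ^ (n + j) \<cdot> y \<in> M" and z: "N ^ n \<cdot> y - N ^ Suc n \<cdot> z \<in> M"
      using step by meson
    have "(N ^ n \<cdot> x - N ^ (n + j) \<cdot> y) + N ^ j \<cdot> (N ^ n \<cdot> y - N ^ Suc n \<cdot> z)
        = N ^ n \<cdot> x - N ^ (n + Suc j) \<cdot> z"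
      by (simp add: Z.scale_right_diff_distrib power_add mult.commute mult.left_commute)
    then show ?case using Z.subspace_add[OF M y Z.subspace_scale[OF M z]] by metis
  qed
  have "\<exists>y. N ^ n \<cdot> (x - N ^ n \<cdot> y) \<in> M" for x
    using iter[of x n] by (simp add: Z.scale_right_diff_distrib power_add)
  then show ?thesis using step by blast
qed

lemma finite_image_fin_mod:
  assumes "lin h" "fin_mod X M" "\<And>x. x \<in> M \<Longrightarrow> h x = 0"
  shows "finite (h ` X)"
proof -
  obtain E where E: "finite E" "\<And>x. x \<in> X \<Longrightarrow> \<exists>e\<in>E. x - e \<in> M"
    using assms(2) unfolding fin_mod_def by blast
  have "h ` X \<subseteq> h ` E"
  proof
    fix y assume "y \<in> h ` X"
    then obtain x where x: "x \<in> X" "y = h x" by blast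
    then obtain e where "e \<in> E" "x - e \<in> M" using E by blast
    then have "h x = h e" using assms(3)[of "x - e"] by (simp add: module_hom.diff[OF assms(1)])
    then show "y \<in> h ` E" using x \<open>e \<in> E\<close> by blast
  qed
  then show ?thesis using E finite_subset by blast
qed

text \<open>Let \<open>C\<close> be a complement of \<open>D\<close>. Since \<open>h\<close> kills \<open>D\<close>, already \<open>h C\<close> contains \<open>D\<close>; so \<open>D\<close> is finite
  modulo \<open>C\<close>, hence finite.\<close>

lemma inert_divisible_image_trivial:
  assumes h: "inert h" and D: "Z.subspace D" "D \<subseteq> range h" and zero: "\<And>d. d \<in> D \<Longrightarrow> h d = 0"
    and N: "(N::int) > 0" and div: "\<And>d. d \<in> D \<Longrightarrow> \<exists>d'\<in>D. d = N \<cdot> d'"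
    and prim: "\<And>d. d \<in> D \<Longrightarrow> \<exists>k::nat. N ^ k \<cdot> d = 0"
  shows "D \<subseteq> {0}"
proof -
  have "\<exists>d'\<in>D. d = k \<cdot> d'" if "k > 0" "d \<in> D" for k d
    using divisible_primary_divisible[OF D(1) N div prim, of "nat k" d] that by simp
  then obtain C where C: "Z.subspace C" "C \<inter> D = {0}" "\<And>a. \<exists>d\<in>D. a - d \<in> C"
    using divisible_complement[OF D(1)] by metis
  have "D \<subseteq> h ` C"
  proof
    fix d assume "d \<in> D"
    then obtain a where "d = h a" using D by blast
    moreover obtain d' where d': "d' \<in> D" "a - d' \<in> C" using C by blast
    ultimately have "d = h (a - d')" using zero by (simp add: module_hom.diff[OF inert_lin[OF h]])
    then show "d \<in> h ` C" using d' by blast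
  qed
  then have "fin_mod D C" using inert_fin_mod[OF h C(1)] fin_mod_mono by blast
  then have "finite D" by (rule finite_if_fin_mod[OF _ subset_refl D(1) C(1)]) (use C in blast)
  \<comment> \<open>One power of \<open>N\<close> kills the finite \<open>N\<close>-primary group
    \<open>D\<close>, yet by divisibility every element of \<open>D\<close> is a multiple by that
    power.\<close>
  then have "\<exists>K. \<forall>d\<in>D. N ^ K \<cdot> d \<in> {0}" by (rule common_power) (use prim in auto)
  then obtain K where K: "\<And>d. d \<in> D \<Longrightarrow> N ^ K \<cdot> d = 0" by auto
  show "D \<subseteq> {0}"
  proof
    fix d assume "d \<in> D"
    then obtain d' where "d' \<in> D" "d = N ^ K \<cdot> d'" using divisible_power[OF div] by blast
    then show "d \<in> {0}" using K by simp
  qed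
qed

theorem inert_commutator_finite:
  assumes f: "inert f" and g: "inert g"
  shows "finite (range (\<lambda>x. f (g x) - g (f x)))"
proof -
  define h where "h x = f (g x) - g (f x)" for x
  have h: "inert h" unfolding h_def by (rule inert_diff[OF inert_comp[OF f g] inert_comp[OF g f]])
  note lin_f = inert_lin[OF f] and lin_g = inert_lin[OF g] and lin_h = inert_lin[OF h]
  obtain R :: "'a set" where R: "Z.subspace R" "R \<inter> torsion = {0}" "\<And>x. \<exists>k>0. k \<cdot> x \<in> R"
    using torsion_free_cotorsion by metis
  have "\<exists>M. cochernikov M \<and> (\<forall>f'\<in>{f, g}. \<forall>x\<in>M. \<exists>k. f' x - k \<cdot> x \<in> R)"
    using inert_almost_multiple_finite[of "{f, g}", OF _ _ R(1,3)] f g by blast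
  then obtain M where M: "cochernikov M" "\<And>x. x \<in> M \<Longrightarrow> \<exists>k. f x - k \<cdot> x \<in> R"
    "\<And>x. x \<in> M \<Longrightarrow> \<exists>k. g x - k \<cdot> x \<in> R"
    by blast
  have sM: "Z.subspace M" using M(1) by (simp add: cochernikov_def)
  \<comment> \<open>If \<open>f x = r + k \<cdot> x\<close> and \<open>g x = s + l \<cdot> x\<close>
    with \<open>r\<close>, \<open>s\<close> in \<open>R\<close>, then the multiples of
    \<open>x\<close> cancel in \<open>h x\<close> and an element of \<open>U\<close> remains.
    \<open>U\<close> is finite modulo \<open>R\<close>, and \<open>R\<close> meets the torsion
    trivially.\<close>
  define U where "U = {t \<in> torsion. \<exists>r\<in>R. \<exists>a\<in>R. \<exists>b\<in>R. t = r + f a - g b}"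
  have "fin_mod U R"
  proof -
    obtain A where A: "finite A" "\<And>x. x \<in> R \<Longrightarrow> \<exists>e\<in>A. f x - e \<in> R"
      using inert_fin_mod[OF f R(1)] unfolding fin_mod_def by auto
    obtain B where B: "finite B" "\<And>x. x \<in> R \<Longrightarrow> \<exists>e\<in>B. g x - e \<in> R"
      using inert_fin_mod[OF g R(1)] unfolding fin_mod_def by auto
    have "\<exists>e\<in>(\<lambda>(a, b). a - b) ` (A \<times> B). t - e \<in> R" if t: "t \<in> U" for t
    proof -
      obtain r a b where r: "r \<in> R" "a \<in> R" "b \<in> R" "t = r + f a - g b" using t by (auto simp: U_def)
      obtain u v where u: "u \<in> A" "f a - u \<in> R" and v: "v \<in> B" "g b - v \<in> R" using A B r by meson
      have "r + (f a - u) - (g b - v) \<in> R"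
        by (rule Z.subspace_diff[OF R(1) Z.subspace_add[OF R(1) r(1) u(2)] v(2)])
      moreover have "r + (f a - u) - (g b - v) = t - (u - v)" using r by (simp add: algebra_simps)
      ultimately show ?thesis using u v by force
    qed
    then show ?thesis
      unfolding fin_mod_def using A B by (intro exI[of _ "(\<lambda>(a, b). a - b) ` (A \<times> B)"]) auto
  qed
  then have "finite U"
    by (rule finite_if_fin_mod[OF _ _ subspace_torsion R(1)]) (use R in \<open>auto simp: U_def\<close>)
  have "h x \<in> U" if x: "x \<in> M" for x
  proof -
    obtain k where k: "f x - k \<cdot> x \<in> R" using M x by blast
    obtain l where l: "g x - l \<cdot> x \<in> R" using M x by blast
    define r s where "r = f x - k \<cdot> x" and "s = g x - l \<cdot> x"
    have *: "f x = r + k \<cdot> x" "g x = s + l \<cdot> x" by (simp_all add: r_def s_def)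
    have "h x = f (s + l \<cdot> x) - g (r + k \<cdot> x)" unfolding h_def by (simp only: *)
    also have "\<dots> = f s + l \<cdot> f x - (g r + k \<cdot> g x)"
      by (simp only: module_hom.add[OF lin_f] module_hom.add[OF lin_g]
          module_hom.scale[OF lin_f] module_hom.scale[OF lin_g])
    also have "\<dots> = (l \<cdot> r - k \<cdot> s) + f s - g r"
      unfolding * by (simp add: Z.scale_right_distrib mult.commute)
    finally have "h x = (l \<cdot> r - k \<cdot> s) + f s - g r" .
    moreover have "l \<cdot> r - k \<cdot> s \<in> R" "r \<in> R" "s \<in> R"
      using k l Z.subspace_diff[OF R(1) Z.subspace_scale[OF R(1)] Z.subspace_scale[OF R(1)]]
      by (auto simp: r_def s_def)
    moreover have "h x \<in> torsion" unfolding h_def by (rule inert_commutator_torsion[OF f g])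
    ultimately show ?thesis unfolding U_def by blast
  qed
  then have "finite (h ` M)" using \<open>finite U\<close> by (meson finite_subset image_subsetI)
  define K where "K = {x \<in> M. h x \<in> {0}}"
  have K: "Z.subspace K" "K \<subseteq> M"
    unfolding K_def by (rule subspace_vimage_Int[OF sM Z.subspace_single_0 lin_h]) auto
  have "fin_mod M K"
  proof (rule fin_mod_pullback[OF sM lin_h Z.subspace_single_0])
    show "fin_mod (h ` M) {0}" by (rule fin_mod_finite[OF \<open>finite (h ` M)\<close> Z.subspace_single_0])
    show "fin_mod {x \<in> M. h x \<in> {0}} K" by (rule fin_mod_subset) (simp add: K_def)
  qed
  then have "cochernikov K" by (rule cochernikov_finite_index[OF M(1) K])
  then obtain N where N: "N > 0" "\<And>x. \<exists>k::nat. N ^ k \<cdot> x \<in> K" "\<And>q. q > 0 \<Longrightarrow> fin_mod {x. q \<cdot> x \<in> K} K"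
    unfolding cochernikov_def by metis
  have hK: "h x = 0" if "x \<in> K" for x using that by (simp add: K_def)
  obtain n where n: "\<And>x. \<exists>y. N ^ n \<cdot> x - N ^ Suc n \<cdot> y \<in> K" "\<And>x. \<exists>y. N ^ n \<cdot> (x - N ^ n \<cdot> y) \<in> K"
    using cochernikov_powers_stabilise[OF K(1) N(3)[OF N(1)] N(2)] by blast
  \<comment> \<open>The image under \<open>h\<close> of the part of \<open>A\<close> that is
    \<open>N\<close>-divisible modulo \<open>K\<close>. Since \<open>h\<close> kills
    \<open>K\<close>, \<open>D\<close> is genuinely \<open>N\<close>-divisible and
    \<open>N\<close>-primary.\<close>
  define D where "D = range (\<lambda>x. h (N ^ n \<cdot> x))"
  have D: "Z.subspace D"
    unfolding D_def by (rule module_hom.subspace_image[OF lin_comp[OF lin_h lin_zmul] Z.subspace_UNIV])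
  have div: "\<exists>d'\<in>D. d = N \<cdot> d'" if d: "d \<in> D" for d
  proof -
    obtain x where x: "d = h (N ^ n \<cdot> x)" using d by (auto simp: D_def)
    obtain y where "N ^ n \<cdot> x - N ^ Suc n \<cdot> y \<in> K" using n by blast
    then have "h (N ^ n \<cdot> x) = h (N ^ Suc n \<cdot> y)" using hK module_hom.diff[OF lin_h] by force
    also have "\<dots> = N \<cdot> h (N ^ n \<cdot> y)"
      by (simp add: module_hom.scale[OF lin_h])
    finally show ?thesis using x by (auto simp: D_def)
  qed
  have prim: "\<exists>k::nat. N ^ k \<cdot> d = 0" if d: "d \<in> D" for d
  proof -
    obtain x where x: "d = h x" using d by (auto simp: D_def)
    obtain k :: nat where "N ^ k \<cdot> x \<in> K" using N by blast
    then have "N ^ k \<cdot> d = 0" using hK x module_hom.scale[OF lin_h] by metis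
    then show ?thesis by blast
  qed
  have zero: "h d = 0" if d: "d \<in> D" for d
  proof -
    obtain i j where "f d = i \<cdot> d" "g d = j \<cdot> d"
      using inert_multiple_on_divisible[OF f D div prim N(1) d]
        inert_multiple_on_divisible[OF g D div prim N(1) d] by blast
    then show ?thesis
      by (simp add: h_def module_hom.scale[OF lin_f] module_hom.scale[OF lin_g] mult.commute)
  qed
  have "D \<subseteq> {0}"
    by (rule inert_divisible_image_trivial[OF h D _ zero N(1) div prim]) (auto simp: D_def)
  then have D0: "h (N ^ n \<cdot> y) = 0" for y by (auto simp: D_def)
  \<comment> \<open>\<open>D\<close> being trivial, \<open>h\<close> does not change when a multiple
    by \<open>N ^ n\<close> is subtracted, and such a subtraction moves any \<open>x\<close> into a
    subgroup that is finite modulo \<open>K\<close>.\<close>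
  have "range h \<subseteq> h ` {x. N ^ n \<cdot> x \<in> K}"
  proof
    fix z assume "z \<in> range h"
    then obtain x where x: "z = h x" by blast
    obtain y where "N ^ n \<cdot> (x - N ^ n \<cdot> y) \<in> K" using n by blast
    moreover have "h (x - N ^ n \<cdot> y) = z" using D0 x by (simp add: module_hom.diff[OF lin_h])
    ultimately show "z \<in> h ` {x. N ^ n \<cdot> x \<in> K}" by blast
  qed
  moreover have "finite (h ` {x. N ^ n \<cdot> x \<in> K})"
    by (rule finite_image_fin_mod[OF lin_h N(3) hK]) (use N in auto)
  ultimately show ?thesis unfolding h_def using finite_subset by blast
qed

section \<open>Invariant subgroups of finitely many inertial endomorphisms\<close>

lemma fin_mod_Inter:
  assumes "finite I" "\<And>i. i \<in> I \<Longrightarrow> Z.subspace (S i) \<and> fin_mod UNIV (S i)"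
  shows "Z.subspace (\<Inter>i\<in>I. S i) \<and> fin_mod UNIV (\<Inter>i\<in>I. S i)"
  using assms
proof (induction I)
  case empty
  then show ?case by (simp add: fin_mod_subset)
next
  case (insert i I)
  then have "Z.subspace (S i)" "Z.subspace (\<Inter>i\<in>I. S i)" "fin_mod UNIV (S i)" "fin_mod UNIV (\<Inter>i\<in>I. S i)"
    by auto
  then show ?case
    using fin_mod_Int[of "S i" "\<Inter>i\<in>I. S i"] Z.subspace_inter[of "S i" "\<Inter>i\<in>I. S i"] by simp
qed

lemma fin_mod_kernel:
  assumes h: "lin h" and "finite (range h)"
  shows "fin_mod UNIV {x. h x = 0}"
proof (rule fin_mod_pullback[OF Z.subspace_UNIV h Z.subspace_single_0])
  show "fin_mod (range h) {0}" by (rule fin_mod_finite[OF assms(2) Z.subspace_single_0])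
qed (auto intro: fin_mod_subset)

lemma finite_range_torsion:
  assumes "lin h" "finite (range h)"
  shows "range h \<subseteq> torsion"
proof
  fix x assume "x \<in> range h"
  moreover have "Z.subspace (range h)"
    by (rule module_hom.subspace_image[OF assms(1) Z.subspace_UNIV])
  moreover have "fin_mod (range h) {0}" by (rule fin_mod_finite[OF assms(2) Z.subspace_single_0])
  ultimately have "\<exists>k>0. k \<cdot> x \<in> {0}" using fin_mod_torsion Z.subspace_single_0 by blast
  then show "x \<in> torsion" by (simp add: torsion_def)
qed

text \<open>A single \<open>e\<close> kills all values of commutators, so they lie in the subgroup
  \<open>T\<close> killed by \<open>e\<close>, which is finite modulo \<open>M\<close>. On
  \<open>T \<inter> M\<close> the maps act by true multiples because \<open>R\<close> is
  torsion-free; only the finitely many representatives and the errors they cause need care.\<close>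

lemma inert_invariant_finite_subspace:
  assumes fin: "finite \<Phi>" and \<Phi>: "\<And>f. f \<in> \<Phi> \<Longrightarrow> inert f"
  obtains W where "finite W" "Z.subspace W" "\<And>f x. f \<in> \<Phi> \<Longrightarrow> x \<in> W \<Longrightarrow> f x \<in> W"
    "\<And>f g x. f \<in> \<Phi> \<Longrightarrow> g \<in> \<Phi> \<Longrightarrow> f (g x) - g (f x) \<in> W"
proof -
  define V where "V = (\<Union>(f, g)\<in>\<Phi> \<times> \<Phi>. range (\<lambda>x. f (g x) - g (f x)))"
  have V: "finite V" unfolding V_def using fin \<Phi> inert_commutator_finite by auto
  have "V \<subseteq> torsion" unfolding V_def using inert_commutator_torsion[OF \<Phi> \<Phi>] by auto
  have "\<exists>e>0. \<forall>v\<in>V. e \<cdot> v \<in> {0}"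
    by (rule common_multiple[OF V]) (use \<open>V \<subseteq> torsion\<close> in \<open>auto simp: torsion_def\<close>)
  then obtain e where e: "e > 0" "\<And>v. v \<in> V \<Longrightarrow> e \<cdot> v = 0" by auto
  obtain R :: "'a set" where R: "Z.subspace R" "R \<inter> torsion = {0}" "\<And>x. \<exists>k>0. k \<cdot> x \<in> R"
    using torsion_free_cotorsion by metis
  obtain M where M: "cochernikov M" "\<And>f x. f \<in> \<Phi> \<Longrightarrow> x \<in> M \<Longrightarrow> \<exists>k. f x - k \<cdot> x \<in> R"
    using inert_almost_multiple_finite[OF fin \<Phi> R(1,3)] by blast
  have sM: "Z.subspace M" using M(1) by (simp add: cochernikov_def)
  define T where "T = {x :: 'a. e \<cdot> x \<in> {0}}"
  have T: "Z.subspace T" unfolding T_def by (rule subspace_zmul_in) simp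
  have Tt: "T \<subseteq> torsion" using e(1) by (auto simp: T_def torsion_def)
  have fT: "f x \<in> T" if "f \<in> \<Phi>" "x \<in> T" for f x
    using that inert_lin[OF \<Phi>[OF that(1)]]
    by (simp add: T_def module_hom.zero flip: module_hom.scale)
  have "fin_mod {x. e \<cdot> x \<in> M} M" using M(1) e(1) by (simp add: cochernikov_def)
  then have "fin_mod T M"
    by (rule fin_mod_mono) (auto simp: T_def Z.subspace_0[OF sM])
  then obtain E where E: "finite E" "E \<subseteq> T" "\<And>x. x \<in> T \<Longrightarrow> \<exists>e\<in>E. x - e \<in> M"
    using fin_mod_reps[OF _ sM] by metis
  define A where "A = E \<union> V"
  have A: "finite A" "A \<subseteq> T" using E V e by (auto simp: A_def T_def)
  \<comment> \<open>The errors in \<open>M\<close> that arise when the image of a generator in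
    \<open>A\<close> is replaced by a representative in \<open>E\<close>. They cause no new errors,
    as each lies in \<open>T \<inter> M\<close> and is mapped to a multiple of itself.\<close>
  define B where "B = M \<inter> (\<lambda>(f, a, b). f a - b) ` (\<Phi> \<times> A \<times> E)"
  have B: "finite B" unfolding B_def using fin A E by blast
  have BT: "B \<subseteq> T"
  proof
    fix y assume "y \<in> B"
    then obtain f a b where "f \<in> \<Phi>" "a \<in> A" "b \<in> E" "y = f a - b" by (auto simp: B_def)
    then show "y \<in> T" using Z.subspace_diff[OF T] fT A(2) E(2) by blast
  qed
  define W where "W = Z.span (A \<union> B)"
  have W: "Z.subspace W" by (simp add: W_def)
  show thesis
  proof
    show "finite W" unfolding W_def using A B BT Tt by (intro finite_span_torsion) auto
    show "Z.subspace W" by (rule W)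
    show "f (g x) - g (f x) \<in> W" if "f \<in> \<Phi>" "g \<in> \<Phi>" for f g x
    proof -
      have "f (g x) - g (f x) \<in> V" using that unfolding V_def by blast
      then show ?thesis by (auto simp: W_def A_def intro: Z.span_base)
    qed
    fix f x assume f: "f \<in> \<Phi>" and x: "x \<in> W"
    have "A \<union> B \<subseteq> {x. f x \<in> W}"
    proof
      fix y assume "y \<in> A \<union> B"
      then consider "y \<in> A" | "y \<in> B" by blast
      then show "y \<in> {x. f x \<in> W}"
      proof cases
        case 1
        then obtain b where b: "b \<in> E" "f y - b \<in> M" using E(3) fT[OF f] A by blast
        then have "f y - b \<in> B" using f 1 by (force simp: B_def)
        then have "(f y - b) + b \<in> W"
          using b by (intro Z.subspace_add[OF W]) (auto simp: W_def A_def intro: Z.span_base)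
        then show ?thesis by simp
      next
        case 2
        then have y: "y \<in> M" "y \<in> T" using BT unfolding B_def by blast+
        then obtain k where k: "f y - k \<cdot> y \<in> R" using M f by blast
        have "f y - k \<cdot> y \<in> T"
          using fT[OF f] y Z.subspace_diff[OF T] Z.subspace_scale[OF T] by blast
        then have "f y - k \<cdot> y = 0" using k Tt R(2) by blast
        moreover have "k \<cdot> y \<in> W"
          unfolding W_def by (rule Z.span_scale[OF Z.span_base]) (use 2 in simp)
        ultimately show ?thesis by simp
      qed
    qed
    then have "W \<subseteq> {x. f x \<in> W}"
      unfolding W_def
      by (rule Z.span_minimal)
         (rule module_hom.subspace_linear_preimage[OF inert_lin[OF \<Phi>[OF f]] Z.subspace_span])
    then show "f x \<in> W" using x by blast
  qed
qed

text \<open>\<open>C\<close> is where all the maps commute, and \<open>e\<close> kills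
  \<open>A / C\<close>, so \<open>R = e A\<close> lies in \<open>C\<close>. As \<open>R\<close> is
  preserved by every endomorphism, it also lies in \<open>M\<close>. Hence \<open>f x\<close>
  differs from a multiple of \<open>x\<close> by an element of \<open>C \<inter> M\<close>, which
  makes \<open>C \<inter> M\<close> invariant.\<close>

lemma inert_invariant_cofinite_subspace:
  assumes fin: "finite \<Phi>" and \<Phi>: "\<And>f. f \<in> \<Phi> \<Longrightarrow> inert f"
  obtains K where "fin_mod UNIV K" "Z.subspace K" "\<And>f x. f \<in> \<Phi> \<Longrightarrow> x \<in> K \<Longrightarrow> f x \<in> K"
    "\<And>f g x. f \<in> \<Phi> \<Longrightarrow> g \<in> \<Phi> \<Longrightarrow> x \<in> K \<Longrightarrow> f (g x) = g (f x)"
proof -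
  define C where "C = (\<Inter>(f, g)\<in>\<Phi> \<times> \<Phi>. {x. f (g x) - g (f x) = 0})"
  have "Z.subspace C \<and> fin_mod UNIV C"
    unfolding C_def
  proof (rule fin_mod_Inter)
    fix i assume "i \<in> \<Phi> \<times> \<Phi>"
    then obtain f g where i: "i = (f, g)" "inert f" "inert g" using \<Phi> by auto
    define h where "h x = f (g x) - g (f x)" for x
    have h: "lin h" unfolding h_def
      by (rule inert_lin[OF inert_diff[OF inert_comp[OF i(2,3)] inert_comp[OF i(3,2)]]])
    have "finite (range h)" unfolding h_def using i by (intro inert_commutator_finite)
    then have "Z.subspace {x. h x = 0} \<and> fin_mod UNIV {x. h x = 0}"
      using fin_mod_kernel[OF h] module_hom.subspace_kernel[OF h] by blast
    then show "Z.subspace (case i of (f, g) \<Rightarrow> {x. f (g x) - g (f x) = 0}) \<and>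
        fin_mod UNIV (case i of (f, g) \<Rightarrow> {x. f (g x) - g (f x) = 0})"
      by (simp add: i h_def)
  qed (use fin in simp)
  then have C: "Z.subspace C" "fin_mod UNIV C" by auto
  then obtain e where e: "e > 0" "\<And>x. e \<cdot> x \<in> C"
    using fin_mod_exponent[OF C(2) Z.subspace_UNIV C(1)] by blast
  define R where "R = range ((\<cdot>) e :: 'a \<Rightarrow> 'a)"
  have R: "Z.subspace R" unfolding R_def by (rule module_hom.subspace_image[OF lin_zmul Z.subspace_UNIV])
  have "\<exists>k>0. k \<cdot> x \<in> R" for x using e(1) by (auto simp: R_def)
  then obtain M where M: "cochernikov M" "\<And>f x. f \<in> \<Phi> \<Longrightarrow> x \<in> M \<Longrightarrow> \<exists>k. f x - k \<cdot> x \<in> R"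
    "{x \<in> R. \<forall>f\<in>\<Phi>. f x \<in> R} \<subseteq> M"
    using inert_almost_multiple_finite[OF fin \<Phi> R] by blast
  have sM: "Z.subspace M" using M(1) by (simp add: cochernikov_def)
  have "R \<subseteq> {x \<in> R. \<forall>f\<in>\<Phi>. f x \<in> R}"
    using module_hom.scale[OF inert_lin[OF \<Phi>]] by (auto simp: R_def)
  then have RM: "R \<subseteq> M" using M(3) by blast
  have RC: "R \<subseteq> C" using e(2) by (auto simp: R_def)
  have "fin_mod {x. e \<cdot> x \<in> M} M" using M(1) e(1) by (simp add: cochernikov_def)
  \<comment> \<open>Here \<open>e\<close> kills the Chernikov group \<open>A / M\<close>, which is
    therefore finite.\<close>
  moreover have "{x. e \<cdot> x \<in> M} = UNIV" using RM by (auto simp: R_def)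
  ultimately have fM: "fin_mod UNIV M" by simp
  show thesis
  proof
    show "fin_mod UNIV (C \<inter> M)" by (rule fin_mod_Int[OF C(1) sM C(2) fM])
    show "Z.subspace (C \<inter> M)" by (rule Z.subspace_inter[OF C(1) sM])
    show "f (g x) = g (f x)" if "f \<in> \<Phi>" "g \<in> \<Phi>" "x \<in> C \<inter> M" for f g x
      using that by (auto simp: C_def)
    fix f x assume f: "f \<in> \<Phi>" and x: "x \<in> C \<inter> M"
    then obtain k where k: "f x - k \<cdot> x \<in> R" using M by blast
    then have "f x - k \<cdot> x \<in> C \<inter> M" using RM RC by blast
    moreover have "k \<cdot> x \<in> C \<inter> M" using x Z.subspace_scale C sM by blast
    ultimately have "(f x - k \<cdot> x) + k \<cdot> x \<in> C \<inter> M"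
      using Z.subspace_add[OF Z.subspace_inter[OF C(1) sM]] by blast
    then show "f x \<in> C \<inter> M" by simp
  qed
qed

section \<open>Invariance under inverses\<close>

lemma invariant_finite_reflects:
  assumes "inj f" "finite W" "\<And>x. x \<in> W \<Longrightarrow> f x \<in> W" "f x \<in> W"
  shows "x \<in> W"
proof -
  have "f ` W = W" using assms by (meson endo_inj_surj image_subsetI inj_on_subset subset_UNIV)
  then show ?thesis using assms by (metis imageE injD)
qed

text \<open>Among successive preimages \<open>s n\<close> of \<open>x\<close>, two agree modulo
  \<open>K\<close>. Applying \<open>f ^^ j\<close> to their difference shows that \<open>x\<close>
  agrees modulo \<open>K\<close> with some \<open>(f ^^ Suc d) x\<close>, which lies in
  \<open>K\<close> because \<open>f x\<close> does.\<close>

lemma invariant_cofinite_reflects: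
  assumes f: "lin f" "surj f" and K: "Z.subspace K" "fin_mod UNIV K"
    and inv: "\<And>x. x \<in> K \<Longrightarrow> f x \<in> K" and x: "f x \<in> K"
  shows "x \<in> K"
proof -
  define s where "s n = (inv_into UNIV f ^^ n) x" for n
  have fs: "f (s (Suc n)) = s n" for n using f(2) by (simp add: s_def surj_f_inv_f)
  have pw: "(f ^^ n) (s (n + j)) = s j" for n j
  proof (induction n)
    case (Suc n)
    have "(f ^^ Suc n) (s (Suc n + j)) = (f ^^ n) (f (s (Suc (n + j))))" by (simp add: funpow_swap1)
    then show ?case using Suc by (simp only: fs)
  qed (simp add: s_def)
  have K_pow: "(f ^^ n) y \<in> K" if "y \<in> K" for n y by (induction n) (use that inv in auto)
  have infinite: "infinite (UNIV :: nat set)" by simp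
  obtain i j :: nat where ij: "i < j" "s j - s i \<in> K"
    by (rule fin_mod_pigeonhole[OF K(2,1) infinite, of s]) auto
  have lin: "lin (f ^^ n)" for n
  proof (induction n)
    case (Suc n)
    then show ?case using f(1) lin_comp[of f "f ^^ n"] by (simp add: o_def)
  qed (simp add: lin_id id_def)
  obtain d where d: "j = i + Suc d" using ij less_iff_Suc_add by auto
  have "(f ^^ j) (s j - s i) \<in> K" using ij K_pow by blast
  moreover have "(f ^^ j) (s j) = x" using pw[of j 0] by (simp add: s_def)
  moreover have "(f ^^ j) (s i) = (f ^^ Suc d) x"
  proof -
    have "(f ^^ j) (s i) = (f ^^ Suc d) ((f ^^ i) (s (i + 0)))"
      by (simp only: d add.commute[of i] funpow_add o_apply add_0_right)
    also have "\<dots> = (f ^^ Suc d) (s 0)" by (simp only: pw)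
    finally show ?thesis by (simp add: s_def)
  qed
  ultimately have 1: "x - (f ^^ Suc d) x \<in> K" by (simp add: module_hom.diff[OF lin])
  have "(f ^^ Suc d) x = (f ^^ d) (f x)" by (simp add: funpow_swap1)
  then have "(f ^^ Suc d) x \<in> K" using K_pow[OF x] by simp
  then have "(x - (f ^^ Suc d) x) + (f ^^ Suc d) x \<in> K" using 1 Z.subspace_add[OF K(1)] by blast
  then show ?thesis by simp
qed

section \<open>Groups of automorphisms\<close>

lemma coset_of_eq_iff: "Z.subspace X \<Longrightarrow> coset_of X y = coset_of X z \<longleftrightarrow> y - z \<in> X"
proof
  assume X: "Z.subspace X"
  {
    assume "coset_of X y = coset_of X z"
    moreover have "y \<in> coset_of X y" unfolding coset_of_def using Z.subspace_0[OF X] by force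
    ultimately show "y - z \<in> X" by (auto simp: coset_of_def)
  }
  assume yz: "y - z \<in> X"
  have *: "coset_of X a \<subseteq> coset_of X b" if "a - b \<in> X" for a b
  proof
    fix w assume "w \<in> coset_of X a"
    then obtain x where x: "x \<in> X" "w = a + x" by (auto simp: coset_of_def)
    then have "w = b + ((a - b) + x)" by simp
    then show "w \<in> coset_of X b"
      unfolding coset_of_def using Z.subspace_add[OF X that x(1)] by blast
  qed
  have "z - y \<in> X" using Z.subspace_neg[OF X yz] by simp
  then show "coset_of X y = coset_of X z" using * yz by blast
qed

lemma finite_cosets_iff: "Z.subspace X \<Longrightarrow> finite (coset_of X ` Y) \<longleftrightarrow> fin_mod Y X"
proof
  assume X: "Z.subspace X"
  {
    assume "finite (coset_of X ` Y)"
    then obtain E where E: "E \<subseteq> Y" "finite E" "coset_of X ` Y = coset_of X ` E"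
      using finite_subset_image[of "coset_of X ` Y" "coset_of X" Y] by auto
    have "\<exists>e\<in>E. y - e \<in> X" if "y \<in> Y" for y
    proof -
      have "coset_of X y \<in> coset_of X ` E" using that E(3) by blast
      then show ?thesis using coset_of_eq_iff[OF X] by auto
    qed
    then show "fin_mod Y X" unfolding fin_mod_def using E(2) by blast
  }
  assume "fin_mod Y X"
  then obtain E where E: "finite E" "\<And>y. y \<in> Y \<Longrightarrow> \<exists>e\<in>E. y - e \<in> X"
    unfolding fin_mod_def by blast
  then have "coset_of X ` Y \<subseteq> coset_of X ` E" using coset_of_eq_iff[OF X] by blast
  then show "finite (coset_of X ` Y)" using E(1) finite_subset by blast
qed

lemma Auts_lin: "f \<in> Auts \<Longrightarrow> lin f"
  by (auto simp: Auts_def intro: linI)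

lemma Auts_bij: "f \<in> Auts \<Longrightarrow> bij f"
  by (simp add: Auts_def)

lemma inertial_inert:
  assumes "inertial f" shows "inert f"
  unfolding inert_def
proof (intro conjI allI impI)
  show "lin f" using assms Auts_lin by (auto simp: inertial_def)
  fix X :: "'a set" assume X: "Z.subspace X"
  then have "finite (coset_of X ` {f x + y | x y. x \<in> X \<and> y \<in> X})"
    using assms subgrp_iff_subspace unfolding inertial_def by blast
  then have "fin_mod {f x + y | x y. x \<in> X \<and> y \<in> X} X" using finite_cosets_iff[OF X] by blast
  moreover have "f ` X \<subseteq> {f x + y | x y. x \<in> X \<and> y \<in> X}"
  proof
    fix z assume "z \<in> f ` X"
    then obtain x where "x \<in> X" "z = f x + 0" by auto
    then show "z \<in> {f x + y | x y. x \<in> X \<and> y \<in> X}" using Z.subspace_0[OF X] by blast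
  qed
  ultimately show "fin_mod (f ` X) X" using fin_mod_mono by blast
qed

lemma Auts_inv: "f \<in> Auts \<Longrightarrow> inv_into UNIV f \<in> Auts"
proof -
  assume f: "f \<in> Auts"
  note b = Auts_bij[OF f]
  have "inv_into UNIV f (x + y) = inv_into UNIV f x + inv_into UNIV f y" for x y
    by (rule inv_f_eq[OF bij_is_inj[OF b]])
       (simp add: module_hom.add[OF Auts_lin[OF f]] surj_f_inv_f[OF bij_is_surj[OF b]])
  then show ?thesis using bij_imp_bij_inv[OF b] by (simp add: Auts_def)
qed

lemma group_AutG: "group (AutG :: ('a::ab_group_add \<Rightarrow> 'a) monoid)"
proof (rule groupI)
  fix f :: "'a \<Rightarrow> 'a" assume "f \<in> carrier AutG"
  then have f: "f \<in> Auts" by (simp add: AutG_def)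
  have "inv_into UNIV f \<circ> f = id" using inv_o_cancel bij_is_inj[OF Auts_bij[OF f]] by blast
  then show "\<exists>g\<in>carrier AutG. g \<otimes>\<^bsub>AutG\<^esub> f = \<one>\<^bsub>AutG\<^esub>"
    using Auts_inv[OF f] by (auto simp: AutG_def)
qed (auto simp: AutG_def Auts_def bij_comp comp_assoc)

interpretation AutG: group AutG
  by (rule group_AutG)

lemma carrier_AutG: "carrier AutG = Auts"
  and mult_AutG: "f \<otimes>\<^bsub>AutG\<^esub> g = f \<circ> g"
  and one_AutG: "\<one>\<^bsub>AutG\<^esub> = id"
  by (simp_all add: AutG_def)

lemma inv_AutG: "f \<in> Auts \<Longrightarrow> inv\<^bsub>AutG\<^esub> f = inv_into UNIV f"
  by (rule AutG.inv_equality)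
     (simp_all add: mult_AutG one_AutG carrier_AutG Auts_inv inv_o_cancel bij_is_inj[OF Auts_bij])

lemma inv_AutG_apply:
  assumes "f \<in> Auts"
  shows "f ((inv\<^bsub>AutG\<^esub> f) x) = x" "(inv\<^bsub>AutG\<^esub> f) (f x) = x"
  using inv_AutG[OF assms] Auts_bij[OF assms] by (simp_all add: bij_is_inj bij_is_surj surj_f_inv_f)

lemma subgroup_AutG_I:
  assumes "H \<subseteq> Auts" "id \<in> H" "\<And>f g. f \<in> H \<Longrightarrow> g \<in> H \<Longrightarrow> f \<circ> g \<in> H"
    "\<And>f. f \<in> H \<Longrightarrow> inv\<^bsub>AutG\<^esub> f \<in> H"
  shows "subgroup H AutG"
  by (rule AutG.subgroupI) (use assms in \<open>auto simp: carrier_AutG mult_AutG\<close>)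

section \<open>Automorphism groups attached to \<open>K\<close> and \<open>W\<close>\<close>

text \<open>The equivalence expresses that the bijection \<open>f\<close> maps \<open>X\<close> onto
  itself; mere inclusion would not pass to inverses.\<close>

definition stabilizer :: "'a::ab_group_add set \<Rightarrow> ('a \<Rightarrow> 'a) set" where
  "stabilizer X = {f \<in> Auts. \<forall>x. f x \<in> X \<longleftrightarrow> x \<in> X}"

lemma inv_AutG_Auts: "f \<in> Auts \<Longrightarrow> inv\<^bsub>AutG\<^esub> f \<in> Auts"
  using AutG.inv_closed by (simp add: carrier_AutG)

lemma id_Auts: "id \<in> Auts"
  using AutG.one_closed by (simp add: carrier_AutG one_AutG)

lemma comp_Auts: "f \<in> Auts \<Longrightarrow> g \<in> Auts \<Longrightarrow> f \<circ> g \<in> Auts"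
  using AutG.m_closed by (simp add: carrier_AutG mult_AutG)

lemma subgroup_stabilizer: "subgroup (stabilizer X) AutG"
proof (rule subgroup_AutG_I)
  fix f assume "f \<in> stabilizer X"
  then have f: "f \<in> Auts" "\<And>x. f x \<in> X \<longleftrightarrow> x \<in> X" by (auto simp: stabilizer_def)
  have "(inv\<^bsub>AutG\<^esub> f) x \<in> X \<longleftrightarrow> x \<in> X" for x
    using f(2)[of "(inv\<^bsub>AutG\<^esub> f) x"] inv_AutG_apply(1)[OF f(1)] by simp
  then show "inv\<^bsub>AutG\<^esub> f \<in> stabilizer X" using inv_AutG_Auts[OF f(1)] by (simp add: stabilizer_def)
qed (auto simp: stabilizer_def comp_Auts id_Auts)

text \<open>A centralizer of \<open>g\<close> with respect to the actions on \<open>K\<close> and on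
  \<open>A / W\<close>. Being a subgroup, it contains a generated group once it contains the
  generators.\<close>

definition commuting :: "'a::ab_group_add set \<Rightarrow> 'a set \<Rightarrow> ('a \<Rightarrow> 'a) \<Rightarrow> ('a \<Rightarrow> 'a) set" where
  "commuting K W g = {h \<in> stabilizer K \<inter> stabilizer W.
     (\<forall>x\<in>K. g (h x) = h (g x)) \<and> (\<forall>x. g (h x) - h (g x) \<in> W)}"

lemma commuting_sym:
  assumes "Z.subspace W" "h \<in> commuting K W g" "g \<in> stabilizer K \<inter> stabilizer W"
  shows "g \<in> commuting K W h"
proof -
  have "h (g x) - g (h x) \<in> W" for x
    using assms(2) Z.subspace_neg[OF assms(1), of "g (h x) - h (g x)"] by (simp add: commuting_def)
  then show ?thesis using assms by (simp add: commuting_def)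
qed

lemma subgroup_commuting:
  assumes W: "Z.subspace W" and g: "g \<in> stabilizer K \<inter> stabilizer W"
  shows "subgroup (commuting K W g) AutG"
proof (rule subgroup_AutG_I)
  note stab = subgroup_stabilizer[of K] subgroup_stabilizer[of W]
  show "commuting K W g \<subseteq> Auts" by (auto simp: commuting_def stabilizer_def)
  show "id \<in> commuting K W g"
    using subgroup.one_closed[OF stab(1)] subgroup.one_closed[OF stab(2)] Z.subspace_0[OF W]
    by (simp add: commuting_def one_AutG)
  fix f assume f: "f \<in> commuting K W g"
  then have fA: "f \<in> Auts" by (simp add: commuting_def stabilizer_def)
  {
    fix h assume h: "h \<in> commuting K W g"
    have "f \<circ> h \<in> stabilizer K" "f \<circ> h \<in> stabilizer W"
      using f h subgroup.m_closed[OF stab(1)] subgroup.m_closed[OF stab(2)]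
      by (auto simp: commuting_def mult_AutG)
    moreover have "g (f (h x)) = f (h (g x))" if "x \<in> K" for x
      using f h that by (simp add: commuting_def stabilizer_def)
    moreover have "g (f (h x)) - f (h (g x)) \<in> W" for x
    proof -
      have "g (h x) - h (g x) \<in> W" using h by (simp add: commuting_def)
      then have "f (g (h x) - h (g x)) \<in> W" using f by (simp add: commuting_def stabilizer_def)
      moreover have "g (f (h x)) - f (g (h x)) \<in> W" using f by (simp add: commuting_def)
      ultimately have "(g (f (h x)) - f (g (h x))) + f (g (h x) - h (g x)) \<in> W"
        using Z.subspace_add[OF W] by blast
      then show ?thesis by (simp add: module_hom.diff[OF Auts_lin[OF fA]])
    qed
    ultimately show "f \<circ> h \<in> commuting K W g" by (simp add: commuting_def)
  }
  define i where "i = inv\<^bsub>AutG\<^esub> f"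
  have i: "f (i x) = x" "i (f x) = x" for x unfolding i_def by (rule inv_AutG_apply[OF fA])+
  have stab_i: "i \<in> stabilizer K" "i \<in> stabilizer W"
    using f subgroup.m_inv_closed[OF stab(1)] subgroup.m_inv_closed[OF stab(2)]
    by (auto simp: commuting_def i_def)
  moreover have "g (i x) = i (g x)" if "x \<in> K" for x
  proof -
    have "i x \<in> K" using that stab_i by (simp add: stabilizer_def)
    then have "g (f (i x)) = f (g (i x))" using f by (simp add: commuting_def)
    then show ?thesis using i by metis
  qed
  moreover have "g (i x) - i (g x) \<in> W" for x
  proof -
    have "g (f (i x)) - f (g (i x)) \<in> W" using f by (simp add: commuting_def)
    then have "f (i (g x) - g (i x)) \<in> W" by (simp add: i module_hom.diff[OF Auts_lin[OF fA]])
    then have "i (g x) - g (i x) \<in> W" using f by (simp add: commuting_def stabilizer_def)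
    then show ?thesis using Z.subspace_neg[OF W] by fastforce
  qed
  ultimately show "inv\<^bsub>AutG\<^esub> f \<in> commuting K W g" by (simp add: commuting_def i_def)
qed

definition trivial_on :: "'a::ab_group_add set \<Rightarrow> 'a set \<Rightarrow> ('a \<Rightarrow> 'a) set" where
  "trivial_on K W = {f \<in> Auts. (\<forall>x\<in>K. f x = x) \<and> (\<forall>x. f x - x \<in> W)}"

lemma subgroup_trivial_on:
  assumes W: "Z.subspace W"
  shows "subgroup (trivial_on K W) AutG"
proof (rule subgroup_AutG_I)
  show "id \<in> trivial_on K W" using Z.subspace_0[OF W] by (simp add: trivial_on_def id_Auts)
  fix f assume f: "f \<in> trivial_on K W"
  {
    fix g assume g: "g \<in> trivial_on K W"
    have "f (g x) - x \<in> W" for x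
    proof -
      have "(f (g x) - g x) + (g x - x) \<in> W"
        using f g by (intro Z.subspace_add[OF W]) (auto simp: trivial_on_def)
      then show ?thesis by simp
    qed
    then show "f \<circ> g \<in> trivial_on K W" using f g by (simp add: trivial_on_def comp_Auts)
  }
  have fA: "f \<in> Auts" using f by (simp add: trivial_on_def)
  define i where "i = inv\<^bsub>AutG\<^esub> f"
  have i: "f (i x) = x" "i (f x) = x" for x unfolding i_def by (rule inv_AutG_apply[OF fA])+
  have "i x = x" if "x \<in> K" for x using f that i(2)[of x] by (simp add: trivial_on_def)
  moreover have "i x - x \<in> W" for x
  proof -
    have "f (i x) - i x \<in> W" using f by (simp add: trivial_on_def)
    then show ?thesis using Z.subspace_neg[OF W, of "f (i x) - i x"] i by simp
  qed
  ultimately show "inv\<^bsub>AutG\<^esub> f \<in> trivial_on K W"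
    using inv_AutG_Auts[OF fA] by (simp add: trivial_on_def i_def)
qed (auto simp: trivial_on_def)

text \<open>Such an automorphism is determined by its values at finitely many representatives
  \<open>e\<close> modulo \<open>K\<close>, and each value lies in the finite set
  \<open>e + W\<close>.\<close>

lemma finite_trivial_on:
  assumes "finite W" "fin_mod UNIV K"
  shows "finite (trivial_on K W)"
proof -
  obtain E where E: "finite E" "\<And>x. \<exists>e\<in>E. x - e \<in> K" using assms(2) unfolding fin_mod_def by blast
  have "inj_on (\<lambda>f. restrict f E) (trivial_on K W)"
  proof (rule inj_onI, rule ext)
    fix f g x assume fg: "f \<in> trivial_on K W" "g \<in> trivial_on K W" "restrict f E = restrict g E"
    obtain e where e: "e \<in> E" "x - e \<in> K" using E by blast
    then have "f e = g e" using fg by (metis restrict_apply')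
    moreover have "f (x - e) = g (x - e)" using fg e by (simp add: trivial_on_def)
    moreover have "lin f" "lin g" using fg by (auto simp: trivial_on_def intro: Auts_lin)
    ultimately show "f x = g x" by (simp add: module_hom.diff)
  qed
  moreover have "(\<lambda>f. restrict f E) ` trivial_on K W \<subseteq> Pi\<^sub>E E (\<lambda>e. (+) e ` W)"
  proof clarify
    fix f assume f: "f \<in> trivial_on K W"
    show "restrict f E \<in> Pi\<^sub>E E (\<lambda>e. (+) e ` W)"
    proof (rule restrict_PiE_iff[THEN iffD2], rule ballI)
      fix e assume "e \<in> E"
      have "f e - e \<in> W" using f by (simp add: trivial_on_def)
      then show "f e \<in> (+) e ` W" by (intro image_eqI[of _ _ "f e - e"]) auto
    qed
  qed
  moreover have "finite (Pi\<^sub>E E (\<lambda>e. (+) e ` W))" using E assms by (intro finite_PiE) auto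
  ultimately show ?thesis by (meson finite_imageD finite_subset)
qed

lemma inertial_commutators:
  assumes fin: "finite \<Phi>" and \<Phi>: "\<And>f. f \<in> \<Phi> \<Longrightarrow> inertial f"
  obtains K W where "fin_mod UNIV K" "Z.subspace K" "finite W" "Z.subspace W"
    "\<And>g h. g \<in> generate AutG \<Phi> \<Longrightarrow> h \<in> generate AutG \<Phi> \<Longrightarrow>
       g \<otimes>\<^bsub>AutG\<^esub> h \<otimes>\<^bsub>AutG\<^esub> inv\<^bsub>AutG\<^esub> g \<otimes>\<^bsub>AutG\<^esub> inv\<^bsub>AutG\<^esub> h \<in> trivial_on K W"
proof -
  have inert: "inert f" and Auts: "f \<in> Auts" if "f \<in> \<Phi>" for f
    using \<Phi>[OF that] inertial_inert by (auto simp: inertial_def)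
  obtain W where W: "finite W" "Z.subspace W" "\<And>f x. f \<in> \<Phi> \<Longrightarrow> x \<in> W \<Longrightarrow> f x \<in> W"
    "\<And>f g x. f \<in> \<Phi> \<Longrightarrow> g \<in> \<Phi> \<Longrightarrow> f (g x) - g (f x) \<in> W"
    using inert_invariant_finite_subspace[OF fin inert] by metis
  obtain K where K: "fin_mod UNIV K" "Z.subspace K" "\<And>f x. f \<in> \<Phi> \<Longrightarrow> x \<in> K \<Longrightarrow> f x \<in> K"
    "\<And>f g x. f \<in> \<Phi> \<Longrightarrow> g \<in> \<Phi> \<Longrightarrow> x \<in> K \<Longrightarrow> f (g x) = g (f x)"
    using inert_invariant_cofinite_subspace[OF fin inert] by metis
  have "f \<in> stabilizer K" if f: "f \<in> \<Phi>" for f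
    using invariant_cofinite_reflects[OF Auts_lin[OF Auts[OF f]] bij_is_surj[OF Auts_bij[OF Auts[OF f]]] K(2,1)]
      K(3)[OF f] Auts[OF f] unfolding stabilizer_def by blast
  moreover have "f \<in> stabilizer W" if f: "f \<in> \<Phi>" for f
    using invariant_finite_reflects[OF bij_is_inj[OF Auts_bij[OF Auts[OF f]]] W(1)]
      W(3)[OF f] Auts[OF f] unfolding stabilizer_def by blast
  ultimately have stab: "\<Phi> \<subseteq> stabilizer K" "\<Phi> \<subseteq> stabilizer W" by auto
  let ?G = "generate AutG \<Phi>"
  have G: "?G \<subseteq> stabilizer K" "?G \<subseteq> stabilizer W"
    using AutG.generate_subgroup_incl stab subgroup_stabilizer by blast+
  \<comment> \<open>The double centralizer argument: first the whole group commutes with each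
    generator, then by symmetry the generators commute with each element \<open>h\<close>, and so
    does the group they generate.\<close>
  have "?G \<subseteq> commuting K W g" if g: "g \<in> \<Phi>" for g
  proof (rule AutG.generate_subgroup_incl[OF _ subgroup_commuting[OF W(2)]])
    show "g \<in> stabilizer K \<inter> stabilizer W" using stab g by blast
    show "\<Phi> \<subseteq> commuting K W g" using stab g W(4) K(4) by (auto simp: commuting_def)
  qed
  then have "\<Phi> \<subseteq> commuting K W h" if "h \<in> ?G" for h
    using that commuting_sym[OF W(2)] stab by blast
  then have comm: "?G \<subseteq> commuting K W h" if "h \<in> ?G" for h
    using AutG.generate_subgroup_incl[OF _ subgroup_commuting[OF W(2)]] G that by blast
  show thesis
  proof
    fix g h assume gh: "g \<in> ?G" "h \<in> ?G"
    then have A: "g \<in> Auts" "h \<in> Auts" using G by (auto simp: stabilizer_def)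
    define i j where "i = inv\<^bsub>AutG\<^esub> g" and "j = inv\<^bsub>AutG\<^esub> h"
    have ij: "g (i x) = x" "h (j x) = x" for x
      unfolding i_def j_def by (rule inv_AutG_apply[OF A(1)], rule inv_AutG_apply[OF A(2)])
    have ijA: "i \<in> Auts" "j \<in> Auts" unfolding i_def j_def using A inv_AutG_Auts by auto
    have "i \<in> stabilizer K" "j \<in> stabilizer K"
      unfolding i_def j_def using gh G subgroup.m_inv_closed[OF subgroup_stabilizer] by blast+
    then have ijK: "i (j x) \<in> K" if "x \<in> K" for x using that by (simp add: stabilizer_def)
    have c: "h \<in> commuting K W g" using comm gh by blast
    \<comment> \<open>The commutator sends \<open>x\<close> to \<open>g (h y)\<close> with
      \<open>y = i (j x)\<close>, while \<open>h (g y) = x\<close>; so commutation at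
      \<open>y\<close> compares its value with \<open>x\<close>.\<close>
    have eq: "h (g (i (j x))) = x" for x by (simp only: ij)
    have "g (h (i (j x))) = x" if "x \<in> K" for x
      using c ijK[OF that] eq by (simp add: commuting_def)
    moreover have "g (h (i (j x))) - x \<in> W" for x
    proof -
      have "g (h (i (j x))) - h (g (i (j x))) \<in> W" using c by (simp add: commuting_def)
      then show ?thesis by (simp only: eq)
    qed
    moreover have "g \<circ> h \<circ> i \<circ> j \<in> Auts" by (intro comp_Auts A ijA)
    ultimately show "g \<otimes>\<^bsub>AutG\<^esub> h \<otimes>\<^bsub>AutG\<^esub> inv\<^bsub>AutG\<^esub> g \<otimes>\<^bsub>AutG\<^esub> inv\<^bsub>AutG\<^esub> h \<in> trivial_on K W"
      by (simp add: trivial_on_def mult_AutG flip: i_def j_def)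
  qed (use K W in auto)
qed

section \<open>Finitely generated subgroups of an abstract group\<close>

lemma (in group) generate_finite_support:
  assumes "H \<subseteq> carrier G" "x \<in> generate G H"
  shows "\<exists>F\<subseteq>H. finite F \<and> x \<in> generate G F"
  using assms(2)
proof induction
  case one
  then show ?case using generate.one by blast
next
  case (incl h)
  then show ?case by (intro exI[of _ "{h}"]) (auto intro: generate.incl)
next
  case (inv h)
  then show ?case by (intro exI[of _ "{h}"]) (auto intro: generate.inv)
next
  case (eng a b)
  then obtain E F where "E \<subseteq> H" "finite E" "a \<in> generate G E" "F \<subseteq> H" "finite F" "b \<in> generate G F"
    by blast
  then show ?case using mono_generate[of E "E \<union> F"] mono_generate[of F "E \<union> F"]
    by (intro exI[of _ "E \<union> F"]) (auto intro: generate.eng)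
qed

lemma (in group) generate_finite_support_set:
  assumes "H \<subseteq> carrier G" "finite S" "S \<subseteq> generate G H"
  shows "\<exists>F\<subseteq>H. finite F \<and> S \<subseteq> generate G F"
  using assms(2,3)
proof induction
  case (insert x S)
  then obtain E F where "E \<subseteq> H" "finite E" "x \<in> generate G E" "F \<subseteq> H" "finite F" "S \<subseteq> generate G F"
    using generate_finite_support[OF assms(1)] by (metis insert_subset)
  then show ?case using mono_generate[of E "E \<union> F"] mono_generate[of F "E \<union> F"]
    by (intro exI[of _ "E \<union> F"]) auto
qed auto

lemma (in group) centralizer_subgroup:
  assumes "c \<in> carrier G"
  shows "subgroup {x \<in> carrier G. c \<otimes> x = x \<otimes> c} G"
proof (rule subgroupI)
  fix a b assume a: "a \<in> {x \<in> carrier G. c \<otimes> x = x \<otimes> c}"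
  then have [simp]: "a \<in> carrier G" and ca: "c \<otimes> a = a \<otimes> c" by auto
  note [simp] = assms
  have "inv a \<otimes> c = inv a \<otimes> (c \<otimes> a) \<otimes> inv a" by (simp add: m_assoc)
  also have "\<dots> = c \<otimes> inv a" unfolding ca by (simp add: m_assoc[symmetric])
  finally show "inv a \<in> {x \<in> carrier G. c \<otimes> x = x \<otimes> c}" by simp
  assume "b \<in> {x \<in> carrier G. c \<otimes> x = x \<otimes> c}"
  then have [simp]: "b \<in> carrier G" and cb: "c \<otimes> b = b \<otimes> c" by auto
  have "c \<otimes> (a \<otimes> b) = c \<otimes> a \<otimes> b" by (simp add: m_assoc)
  also have "\<dots> = a \<otimes> (c \<otimes> b)" unfolding ca by (simp add: m_assoc)
  also have "\<dots> = a \<otimes> b \<otimes> c" unfolding cb by (simp add: m_assoc)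
  finally show "a \<otimes> b \<in> {x \<in> carrier G. c \<otimes> x = x \<otimes> c}" by simp
qed (use assms in auto)

lemma finite_image_factor:
  assumes "finite (f ` A)" "\<And>x y. x \<in> A \<Longrightarrow> y \<in> A \<Longrightarrow> f x = f y \<Longrightarrow> g x = g y"
  shows "finite (g ` A)"
proof -
  obtain B where B: "B \<subseteq> A" "finite B" "f ` A = f ` B"
    using finite_subset_image[of "f ` A" f A] assms(1) by auto
  have "g ` A \<subseteq> g ` B"
  proof
    fix y assume "y \<in> g ` A"
    then obtain a where a: "a \<in> A" "y = g a" by blast
    then obtain b where "b \<in> B" "f a = f b" using B(3) by blast
    then show "y \<in> g ` B" using a assms(2)[of a b] B(1) by blast
  qed
  then show ?thesis using B(2) finite_subset by blast
qed

text \<open>The coset of \<open>h\<close> modulo the centre is determined by the conjugates of the generators under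
  \<open>h\<close>, and the conjugates of \<open>s\<close> lie in \<open>s L\<close>.\<close>

lemma (in group) central_by_finite_generate:
  assumes S: "finite S" "S \<subseteq> carrier G" and L: "finite L"
    and comm: "\<And>g h. g \<in> generate G S \<Longrightarrow> h \<in> generate G S \<Longrightarrow> inv g \<otimes> inv h \<otimes> g \<otimes> h \<in> L"
  shows "central_by_finite G (generate G S)"
proof -
  let ?H = "generate G S"
  note H = generate_is_subgroup[OF S(2)]
  have HG: "h \<in> carrier G" if "h \<in> ?H" for h using that subgroup.mem_carrier[OF H] by blast
  \<comment> \<open>This is the centre of \<open>?H\<close>, expressed by conditions at the finitely
    many generators only.\<close>
  define Z where "Z = ?H \<inter> (\<Inter>s\<in>S. {x \<in> carrier G. s \<otimes> x = x \<otimes> s})"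
  have "subgroup (\<Inter>T\<in>insert ?H ((\<lambda>s. {x \<in> carrier G. s \<otimes> x = x \<otimes> s}) ` S). T) G"
    using H centralizer_subgroup S(2) by (intro subgroups_Inter) auto
  then have Z: "subgroup Z G" by (simp add: Z_def)
  have central: "z \<otimes> h = h \<otimes> z" if z: "z \<in> Z" and h: "h \<in> ?H" for z h
  proof -
    have "z \<in> carrier G" using z HG by (simp add: Z_def)
    moreover have "S \<subseteq> {x \<in> carrier G. z \<otimes> x = x \<otimes> z}" using z S(2) by (auto simp: Z_def)
    ultimately have "?H \<subseteq> {x \<in> carrier G. z \<otimes> x = x \<otimes> z}"
      using generate_subgroup_incl centralizer_subgroup by blast
    then show ?thesis using h by blast
  qed
  have "finite ((\<lambda>h. Z #> h) ` ?H)"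
  proof (rule finite_image_factor)
    have "(\<lambda>h. \<lambda>s\<in>S. inv h \<otimes> s \<otimes> h) ` ?H \<subseteq> Pi\<^sub>E S (\<lambda>s. (\<otimes>) s ` L)"
    proof clarify
      fix h assume h: "h \<in> ?H"
      show "(\<lambda>s\<in>S. inv h \<otimes> s \<otimes> h) \<in> Pi\<^sub>E S (\<lambda>s. (\<otimes>) s ` L)"
      proof (rule restrict_PiE_iff[THEN iffD2], rule ballI)
        fix s assume s: "s \<in> S"
        have "inv s \<otimes> inv h \<otimes> s \<otimes> h \<in> L" using comm h s generate.incl by metis
        moreover have "inv h \<otimes> s \<otimes> h = s \<otimes> (inv s \<otimes> inv h \<otimes> s \<otimes> h)"
          using s S(2) HG[OF h] by (simp add: subset_iff m_assoc[symmetric])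
        ultimately show "inv h \<otimes> s \<otimes> h \<in> (\<otimes>) s ` L" by blast
      qed
    qed
    moreover have "finite (Pi\<^sub>E S (\<lambda>s. (\<otimes>) s ` L))" using S L by (intro finite_PiE) auto
    ultimately show "finite ((\<lambda>h. \<lambda>s\<in>S. inv h \<otimes> s \<otimes> h) ` ?H)" using finite_subset by blast
    fix g h assume g: "g \<in> ?H" and h: "h \<in> ?H"
      and eq: "(\<lambda>s\<in>S. inv g \<otimes> s \<otimes> g) = (\<lambda>s\<in>S. inv h \<otimes> s \<otimes> h)"
    note [simp] = HG[OF g] HG[OF h]
    have "s \<otimes> (g \<otimes> inv h) = (g \<otimes> inv h) \<otimes> s" if s: "s \<in> S" for s
    proof -
      have [simp]: "s \<in> carrier G" using s S(2) by blast
      have "inv g \<otimes> s \<otimes> g = inv h \<otimes> s \<otimes> h" using fun_cong[OF eq, of s] s by simp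
      then have "g \<otimes> (inv g \<otimes> s \<otimes> g) \<otimes> inv h = g \<otimes> (inv h \<otimes> s \<otimes> h) \<otimes> inv h" by simp
      moreover have "g \<otimes> (inv g \<otimes> s \<otimes> g) \<otimes> inv h = s \<otimes> (g \<otimes> inv h)"
        by (simp add: m_assoc[symmetric])
      moreover have "g \<otimes> (inv h \<otimes> s \<otimes> h) \<otimes> inv h = (g \<otimes> inv h) \<otimes> s"
        by (simp add: m_assoc)
      ultimately show ?thesis by simp
    qed
    moreover have "g \<otimes> inv h \<in> ?H" using H g h by (simp add: subgroup.m_closed subgroup.m_inv_closed)
    ultimately have "g \<otimes> inv h \<in> Z" by (auto simp: Z_def)
    then have "Z #> (g \<otimes> inv h) = Z" by (intro coset_join2 Z) auto
    then have "Z #> (g \<otimes> inv h) #> h = Z #> h" by simp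
    then show "Z #> g = Z #> h"
      using subgroup.subset[OF Z] by (simp add: coset_mult_assoc m_assoc)
  qed
  moreover have "Z \<subseteq> ?H" by (simp add: Z_def)
  ultimately show ?thesis unfolding central_by_finite_def using Z central by blast
qed

section \<open>Automorphisms fixing a subgroup of finite index\<close>

lemma FAut_iff: "f \<in> FAut \<longleftrightarrow> f \<in> Auts \<and> (\<exists>B. Z.subspace B \<and> fin_mod UNIV B \<and> (\<forall>b\<in>B. f b = b))"
  unfolding FAut_def using subgrp_iff_subspace finite_cosets_iff by blast

lemma subgroup_FAut: "subgroup FAut AutG"
proof (rule subgroup_AutG_I)
  show "FAut \<subseteq> Auts" by (auto simp: FAut_def)
  show "id \<in> FAut" by (auto simp: FAut_iff id_Auts intro!: exI[of _ UNIV] fin_mod_subset)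
  fix f :: "'a \<Rightarrow> 'a" assume "f \<in> FAut"
  then obtain B where B: "f \<in> Auts" "Z.subspace B" "fin_mod UNIV B" "\<And>b. b \<in> B \<Longrightarrow> f b = b"
    by (auto simp: FAut_iff)
  {
    fix g :: "'a \<Rightarrow> 'a" assume "g \<in> FAut"
    then obtain C where C: "g \<in> Auts" "Z.subspace C" "fin_mod UNIV C" "\<And>b. b \<in> C \<Longrightarrow> g b = b"
      by (auto simp: FAut_iff)
    show "f \<circ> g \<in> FAut"
      unfolding FAut_iff
      using comp_Auts[OF B(1) C(1)] Z.subspace_inter[OF B(2) C(2)] fin_mod_Int[OF B(2) C(2) B(3) C(3)] B(4) C(4)
      by (intro conjI exI[of _ "B \<inter> C"]) auto
  }
  have "(inv\<^bsub>AutG\<^esub> f) b = b" if "b \<in> B" for b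
    using inv_AutG_apply(2)[OF B(1), of b] B(4)[OF that] by simp
  then show "inv\<^bsub>AutG\<^esub> f \<in> FAut" unfolding FAut_iff using B inv_AutG_Auts by blast
qed

text \<open>Finitely many members fix a common \<open>K\<close> of finite index, and each
  \<open>s - 1\<close> has finite image consisting of torsion elements. These values span a finite
  \<open>W\<close>, so the generated group is contained in the finite group
  \<open>trivial_on K W\<close>.\<close>

lemma locally_finite_FAut: "H \<subseteq> FAut \<Longrightarrow> locally_finite AutG H"
  unfolding locally_finite_def
proof (intro allI impI)
  fix S :: "('a \<Rightarrow> 'a) set" assume "H \<subseteq> FAut" "S \<subseteq> H \<and> finite S"
  then have S: "finite S" "S \<subseteq> FAut" by auto
  have A: "s \<in> Auts" if "s \<in> S" for s using S that by (auto simp: FAut_iff)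
  have lin: "lin (\<lambda>x. s x - x)" if "s \<in> S" for s
    by (rule linI) (simp add: module_hom.add[OF Auts_lin[OF A[OF that]]])
  have ker: "Z.subspace {x. s x - x = 0} \<and> fin_mod UNIV {x. s x - x = 0}" if s: "s \<in> S" for s
  proof -
    obtain B where "fin_mod UNIV B" "\<forall>b\<in>B. s b = b"
      using S(2) s FAut_iff[of s] by blast
    then have "fin_mod UNIV {x. s x - x = 0}" by (auto intro: fin_mod_mono)
    then show ?thesis using module_hom.subspace_kernel[OF lin[OF s]] by blast
  qed
  define K where "K = (\<Inter>s\<in>S. {x. s x - x = 0})"
  have K: "fin_mod UNIV K" using fin_mod_Inter[OF S(1) ker] by (simp add: K_def)
  define V where "V = (\<Union>s\<in>S. range (\<lambda>x. s x - x))"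
  have range: "finite (range (\<lambda>x. s x - x))" if s: "s \<in> S" for s
    by (rule finite_image_fin_mod[OF lin[OF s] conjunct2[OF ker[OF s]]]) simp
  then have "finite V" using S(1) by (simp add: V_def)
  moreover have "V \<subseteq> torsion" unfolding V_def using finite_range_torsion[OF lin range] by blast
  ultimately have W: "finite (Z.span V)" by (rule finite_span_torsion)
  have "S \<subseteq> trivial_on K (Z.span V)"
  proof
    fix s assume s: "s \<in> S"
    then have "s x - x \<in> Z.span V" for x by (intro Z.span_base) (auto simp: V_def)
    then show "s \<in> trivial_on K (Z.span V)" using A[OF s] s by (auto simp: trivial_on_def K_def)
  qed
  then have "generate AutG S \<subseteq> trivial_on K (Z.span V)"
    by (rule AutG.generate_subgroup_incl[OF _ subgroup_trivial_on[OF Z.subspace_span]])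
  then show "finite (generate AutG S)" using finite_trivial_on[OF W K] finite_subset by blast
qed

theorem theoremB:
  shows "derived (AutG :: ('a::ab_group_add \<Rightarrow> 'a) monoid) IAut \<subseteq> FAut
       \<and> locally_finite (AutG :: ('a \<Rightarrow> 'a) monoid) (derived AutG IAut)
       \<and> locally_central_by_finite (AutG :: ('a \<Rightarrow> 'a) monoid) IAut"
proof (intro conjI)
  let ?I = "{\<phi> :: 'a \<Rightarrow> 'a. inertial \<phi>}"
  have I: "?I \<subseteq> carrier AutG" by (auto simp: carrier_AutG inertial_def)
  \<comment> \<open>Finitely many elements of \<open>IAut\<close> are words in finitely many
    inertial automorphisms, so their commutators are controlled by those generators.\<close>
  have reduce: "\<exists>K W. fin_mod UNIV K \<and> Z.subspace K \<and> finite W \<and> (\<forall>g\<in>generate AutG S. \<forall>h\<in>generate AutG S.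
      g \<otimes>\<^bsub>AutG\<^esub> h \<otimes>\<^bsub>AutG\<^esub> inv\<^bsub>AutG\<^esub> g \<otimes>\<^bsub>AutG\<^esub> inv\<^bsub>AutG\<^esub> h \<in> trivial_on K W)"
    if S: "finite S" "S \<subseteq> (IAut :: ('a \<Rightarrow> 'a) set)" for S
  proof -
    obtain \<Phi> where \<Phi>: "\<Phi> \<subseteq> ?I" "finite \<Phi>" "S \<subseteq> generate AutG \<Phi>"
      using AutG.generate_finite_support_set[OF I S(1)] S(2) unfolding IAut_def by blast
    have "subgroup (generate AutG \<Phi>) AutG" using \<Phi>(1) I by (intro AutG.generate_is_subgroup) auto
    then have sub: "generate AutG S \<subseteq> generate AutG \<Phi>" using AutG.generate_subgroup_incl \<Phi>(3) by blast
    obtain K W where KW: "fin_mod UNIV K" "Z.subspace K" "finite W"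
      "\<And>g h. g \<in> generate AutG \<Phi> \<Longrightarrow> h \<in> generate AutG \<Phi> \<Longrightarrow>
        g \<otimes>\<^bsub>AutG\<^esub> h \<otimes>\<^bsub>AutG\<^esub> inv\<^bsub>AutG\<^esub> g \<otimes>\<^bsub>AutG\<^esub> inv\<^bsub>AutG\<^esub> h \<in> trivial_on K W"
      by (rule inertial_commutators[OF \<Phi>(2)]) (use \<Phi>(1) in blast)+
    show ?thesis
    proof (intro exI conjI ballI)
      show "g \<otimes>\<^bsub>AutG\<^esub> h \<otimes>\<^bsub>AutG\<^esub> inv\<^bsub>AutG\<^esub> g \<otimes>\<^bsub>AutG\<^esub> inv\<^bsub>AutG\<^esub> h \<in> trivial_on K W"
        if "g \<in> generate AutG S" "h \<in> generate AutG S" for g h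
        by (rule KW(4)[OF subsetD[OF sub that(1)] subsetD[OF sub that(2)]])
    qed (fact KW(1-3))+
  qed
  have "derived_set AutG IAut \<subseteq> (FAut :: ('a \<Rightarrow> 'a) set)"
  proof
    fix c :: "'a \<Rightarrow> 'a" assume "c \<in> derived_set AutG IAut"
    then obtain g h :: "'a \<Rightarrow> 'a" where gh: "g \<in> IAut" "h \<in> IAut"
      "c = g \<otimes>\<^bsub>AutG\<^esub> h \<otimes>\<^bsub>AutG\<^esub> inv\<^bsub>AutG\<^esub> g \<otimes>\<^bsub>AutG\<^esub> inv\<^bsub>AutG\<^esub> h" by auto
    have gen: "g \<in> generate AutG {g, h}" "h \<in> generate AutG {g, h}" by (auto intro: generate.incl)
    have "finite {g, h}" "{g, h} \<subseteq> IAut" using gh by auto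
    from reduce[OF this] obtain K W where KW: "fin_mod UNIV K" "Z.subspace K"
      and comm: "\<forall>g'\<in>generate AutG {g, h}. \<forall>h'\<in>generate AutG {g, h}.
        g' \<otimes>\<^bsub>AutG\<^esub> h' \<otimes>\<^bsub>AutG\<^esub> inv\<^bsub>AutG\<^esub> g' \<otimes>\<^bsub>AutG\<^esub> inv\<^bsub>AutG\<^esub> h' \<in> trivial_on K W"
      by (elim exE conjE)
    have "c \<in> trivial_on K W" unfolding gh(3) by (rule comm[rule_format, OF gen])
    then show "c \<in> FAut" using KW by (auto simp: FAut_iff trivial_on_def)
  qed
  then show derived: "derived AutG IAut \<subseteq> (FAut :: ('a \<Rightarrow> 'a) set)"
    unfolding derived_def by (rule AutG.generate_subgroup_incl[OF _ subgroup_FAut])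
  then show "locally_finite (AutG :: ('a \<Rightarrow> 'a) monoid) (derived AutG IAut)"
    by (rule locally_finite_FAut)
  show "locally_central_by_finite (AutG :: ('a \<Rightarrow> 'a) monoid) IAut"
    unfolding locally_central_by_finite_def
  proof (intro allI impI)
    fix S :: "('a \<Rightarrow> 'a) set" assume "S \<subseteq> IAut \<and> finite S"
    then have S: "finite S" "S \<subseteq> IAut" by auto
    then have SG: "S \<subseteq> carrier AutG" using AutG.generate_incl[OF I] unfolding IAut_def by blast
    obtain K W where KW: "fin_mod UNIV K" "finite W" and
      L: "\<And>g h. g \<in> generate AutG S \<Longrightarrow> h \<in> generate AutG S \<Longrightarrow>
        g \<otimes>\<^bsub>AutG\<^esub> h \<otimes>\<^bsub>AutG\<^esub> inv\<^bsub>AutG\<^esub> g \<otimes>\<^bsub>AutG\<^esub> inv\<^bsub>AutG\<^esub> h \<in> trivial_on K W"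
      using reduce[OF S] by blast
    show "central_by_finite AutG (generate AutG S)"
    proof (rule AutG.central_by_finite_generate[OF S(1) SG finite_trivial_on[OF KW(2,1)]])
      fix g h assume gh: "g \<in> generate AutG S" "h \<in> generate AutG S"
      have H: "subgroup (generate AutG S) AutG" by (rule AutG.generate_is_subgroup[OF SG])
      have "g \<in> carrier AutG" "h \<in> carrier AutG" using gh subgroup.mem_carrier[OF H] by blast+
      \<comment> \<open>The two conventions for commutators are interchanged by replacing
        \<open>g\<close> and \<open>h\<close> with their inverses.\<close>
      then show "inv\<^bsub>AutG\<^esub> g \<otimes>\<^bsub>AutG\<^esub> inv\<^bsub>AutG\<^esub> h \<otimes>\<^bsub>AutG\<^esub> g \<otimes>\<^bsub>AutG\<^esub> h \<in> trivial_on K W"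
        using L[OF subgroup.m_inv_closed[OF H gh(1)] subgroup.m_inv_closed[OF H gh(2)]] by simp
    qed
  qed
qed

end
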